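(* Let $R$ be a commutative unital ring, $\sigma:R\to R$ an essential unital ring endomorphism, $t\in R$, $A=A(R,\sigma,t)$ the corresponding weak generalized Weyl algebra, and let $M$ be a simple weight $A$-module. Then there is $$\underline{\mathbf m}\in {}_{\infty}Q_{\infty}\cup Q_{\infty}\cup{}_{\infty}Q\cup\bigcup_{n\in\mathbb Z_+}Q_n$$ such that $\mathrm{supp}(M)\subset\underline{\mathbf m}$, i.e. every element of $\mathrm{supp}(M)$ is equal to some term $\mathbf m_i$ of the family $\underline{\mathbf m}$.
   Context: $\mathbb Z_+=\{0,1,2,\dots\}$. $A=A(R,\sigma,t)$ is the unital ring generated over $R$ by $X,Y$ subject to $YX=t$, $XY=\sigma(t)$, $Xr=\sigma(r)X$, $rY=Y\sigma(r)$ for all $r\in R$. $\mathrm{Max}(R)$ is the set of maximal ideals of $R$. For an $A$-module $M$ put $M_{\mathbf m}=\{v\in M:\mathbf m v=0\}$; $M$ is a weight module if $M=\bigoplus_{\mathbf m\in\mathrm{Max}(R)}M_{\mathbf m}$, and $\mathrm{supp}(M)=\{\mathbf m\in\mathrm{Max}(R): M_{\mathbf m}\neq0\}$. The endomorphism $\sigma$ is essential if for every $\mathbf m\in\mathrm{Max}(R)$ the canonical inclusion $\sigma(R)/(\sigma(R)\cap\mathbf m)\hookrightarrow R/\mathbf m$ is surjective. Consider families $\underline{\mathbf m}=(\mathbf m_i)_{i\in I}$ of maximal ideals of $R$ with $\sigma(\mathbf m_i)\subset\mathbf m_{i+1}$ whenever $i,i+1\in I$. Then ${}_\infty Q_\infty$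 is the set of such families with $I=\mathbb Z$; $Q_\infty$ is the set of those with $I=\{0,1,2,\dots\}$ and $\sigma(t)\in\mathbf m_0$; ${}_\infty Q$ is the set of those with $I=\{0,-1,-2,\dots\}$ and $t\in\mathbf m_0$; $Q_n$ is the set of those with $I=\{0,1,\dots,n\}$, $\sigma(t)\in\mathbf m_0$ and $t\in\mathbf m_n$. *)

theory Defs
  imports "HOL-Algebra.Module" "HOL-Algebra.QuotRing"
begin

section \<open>Weak generalized Weyl algebras\<close>

text \<open>
  The ring generated over \<open>R\<close> by \<open>X, Y\<close> subject to relations is built as the quotient of the set
  of ring expressions over \<open>R\<close>, \<open>X\<close>, \<open>Y\<close> by the least congruence that contains the ring axioms,
  the operations of \<open>R\<close> and the defining relations. The zero and the unit of \<open>R\<close> serve as the zero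
  and the unit of the algebra. Note that the map from \<open>R\<close> to the algebra need not be injective
  when \<open>\<sigma>\<close> is not.
\<close>

datatype 'r wterm =
  Scalar 'r
| GenX
| GenY
| Plus "'r wterm" "'r wterm"
| Times "'r wterm" "'r wterm"
| Neg "'r wterm"

definition wterms :: "('r, 's) ring_scheme \<Rightarrow> 'r wterm set"
  where "wterms R = {p. set_wterm p \<subseteq> carrier R}"

inductive_set wgwa_rel :: "('r, 's) ring_scheme \<Rightarrow> ('r \<Rightarrow> 'r) \<Rightarrow> 'r \<Rightarrow> ('r wterm \<times> 'r wterm) set"
  for R (structure) and \<sigma> t where
  refl: "p \<in> wterms R \<Longrightarrow> (p, p) \<in> wgwa_rel R \<sigma> t"
| sym: "(p, q) \<in> wgwa_rel R \<sigma> t \<Longrightarrow> (q, p) \<in> wgwa_rel R \<sigma> t"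
| trans: "\<lbrakk>(p, q) \<in> wgwa_rel R \<sigma> t; (q, u) \<in> wgwa_rel R \<sigma> t\<rbrakk> \<Longrightarrow> (p, u) \<in> wgwa_rel R \<sigma> t"
| plus_cong: "\<lbrakk>(p, p') \<in> wgwa_rel R \<sigma> t; (q, q') \<in> wgwa_rel R \<sigma> t\<rbrakk>
    \<Longrightarrow> (Plus p q, Plus p' q') \<in> wgwa_rel R \<sigma> t"
| times_cong: "\<lbrakk>(p, p') \<in> wgwa_rel R \<sigma> t; (q, q') \<in> wgwa_rel R \<sigma> t\<rbrakk>
    \<Longrightarrow> (Times p q, Times p' q') \<in> wgwa_rel R \<sigma> t"
| neg_cong: "(p, p') \<in> wgwa_rel R \<sigma> t \<Longrightarrow> (Neg p, Neg p') \<in> wgwa_rel R \<sigma> t"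
| plus_assoc: "\<lbrakk>p \<in> wterms R; q \<in> wterms R; u \<in> wterms R\<rbrakk>
    \<Longrightarrow> (Plus (Plus p q) u, Plus p (Plus q u)) \<in> wgwa_rel R \<sigma> t"
| plus_comm: "\<lbrakk>p \<in> wterms R; q \<in> wterms R\<rbrakk> \<Longrightarrow> (Plus p q, Plus q p) \<in> wgwa_rel R \<sigma> t"
| plus_zero: "p \<in> wterms R \<Longrightarrow> (Plus (Scalar \<zero>) p, p) \<in> wgwa_rel R \<sigma> t"
| plus_neg: "p \<in> wterms R \<Longrightarrow> (Plus (Neg p) p, Scalar \<zero>) \<in> wgwa_rel R \<sigma> t"
| times_assoc: "\<lbrakk>p \<in> wterms R; q \<in> wterms R; u \<in> wterms R\<rbrakk>
    \<Longrightarrow> (Times (Times p q) u, Times p (Times q u)) \<in> wgwa_rel R \<sigma> t"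
| times_one_left: "p \<in> wterms R \<Longrightarrow> (Times (Scalar \<one>) p, p) \<in> wgwa_rel R \<sigma> t"
| times_one_right: "p \<in> wterms R \<Longrightarrow> (Times p (Scalar \<one>), p) \<in> wgwa_rel R \<sigma> t"
| distrib_right: "\<lbrakk>p \<in> wterms R; q \<in> wterms R; u \<in> wterms R\<rbrakk>
    \<Longrightarrow> (Times (Plus p q) u, Plus (Times p u) (Times q u)) \<in> wgwa_rel R \<sigma> t"
| distrib_left: "\<lbrakk>p \<in> wterms R; q \<in> wterms R; u \<in> wterms R\<rbrakk>
    \<Longrightarrow> (Times u (Plus p q), Plus (Times u p) (Times u q)) \<in> wgwa_rel R \<sigma> t"
| scalar_plus: "\<lbrakk>a \<in> carrier R; b \<in> carrier R\<rbrakk>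
    \<Longrightarrow> (Plus (Scalar a) (Scalar b), Scalar (a \<oplus> b)) \<in> wgwa_rel R \<sigma> t"
| scalar_times: "\<lbrakk>a \<in> carrier R; b \<in> carrier R\<rbrakk>
    \<Longrightarrow> (Times (Scalar a) (Scalar b), Scalar (a \<otimes> b)) \<in> wgwa_rel R \<sigma> t"
| YX: "(Times GenY GenX, Scalar t) \<in> wgwa_rel R \<sigma> t"
| XY: "(Times GenX GenY, Scalar (\<sigma> t)) \<in> wgwa_rel R \<sigma> t"
| Xr: "r \<in> carrier R
    \<Longrightarrow> (Times GenX (Scalar r), Times (Scalar (\<sigma> r)) GenX) \<in> wgwa_rel R \<sigma> t"
| rY: "r \<in> carrier R
    \<Longrightarrow> (Times (Scalar r) GenY, Times GenY (Scalar (\<sigma> r))) \<in> wgwa_rel R \<sigma> t"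

definition wgwa_class :: "('r, 's) ring_scheme \<Rightarrow> ('r \<Rightarrow> 'r) \<Rightarrow> 'r \<Rightarrow> 'r wterm \<Rightarrow> 'r wterm set"
  where "wgwa_class R \<sigma> t p = wgwa_rel R \<sigma> t `` {p}"

definition wgwa :: "('r, 's) ring_scheme \<Rightarrow> ('r \<Rightarrow> 'r) \<Rightarrow> 'r \<Rightarrow> 'r wterm set ring"
  where "wgwa R \<sigma> t =
    \<lparr>carrier = wterms R // wgwa_rel R \<sigma> t,
     mult = (\<lambda>P Q. \<Union>p\<in>P. \<Union>q\<in>Q. wgwa_class R \<sigma> t (Times p q)),
     one = wgwa_class R \<sigma> t (Scalar \<one>\<^bsub>R\<^esub>),
     zero = wgwa_class R \<sigma> t (Scalar \<zero>\<^bsub>R\<^esub>),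
     add = (\<lambda>P Q. \<Union>p\<in>P. \<Union>q\<in>Q. wgwa_class R \<sigma> t (Plus p q))\<rparr>"

definition wgwa_scalar :: "('r, 's) ring_scheme \<Rightarrow> ('r \<Rightarrow> 'r) \<Rightarrow> 'r \<Rightarrow> 'r \<Rightarrow> 'r wterm set"
  where "wgwa_scalar R \<sigma> t r = wgwa_class R \<sigma> t (Scalar r)"

definition wgwa_X :: "('r, 's) ring_scheme \<Rightarrow> ('r \<Rightarrow> 'r) \<Rightarrow> 'r \<Rightarrow> 'r wterm set"
  where "wgwa_X R \<sigma> t = wgwa_class R \<sigma> t GenX"

definition wgwa_Y :: "('r, 's) ring_scheme \<Rightarrow> ('r \<Rightarrow> 'r) \<Rightarrow> 'r \<Rightarrow> 'r wterm set"
  where "wgwa_Y R \<sigma> t = wgwa_class R \<sigma> t GenY"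

lemma wterms_simps [simp]:
  "Scalar a \<in> wterms R \<longleftrightarrow> a \<in> carrier R"
  "GenX \<in> wterms R"
  "GenY \<in> wterms R"
  "Plus p q \<in> wterms R \<longleftrightarrow> p \<in> wterms R \<and> q \<in> wterms R"
  "Times p q \<in> wterms R \<longleftrightarrow> p \<in> wterms R \<and> q \<in> wterms R"
  "Neg p \<in> wterms R \<longleftrightarrow> p \<in> wterms R"
  by (auto simp: wterms_def)

locale wgwa_data = cring R for R (structure) +
  fixes \<sigma> :: "'a \<Rightarrow> 'a" and t :: 'a
  assumes sigma_hom: "\<sigma> \<in> ring_hom R R" and t_carrier: "t \<in> carrier R"
begin

abbreviation "E \<equiv> wgwa_rel R \<sigma> t"
abbreviation "cl \<equiv> wgwa_class R \<sigma> t"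
abbreviation "A \<equiv> wgwa R \<sigma> t"

lemma rel_wterms: "(p, q) \<in> E \<Longrightarrow> p \<in> wterms R \<and> q \<in> wterms R"
  by (induction rule: wgwa_rel.induct)
    (use t_carrier ring_hom_closed[OF sigma_hom] in auto)

lemma equiv_rel: "equiv (wterms R) E"
  by (rule equivI)
    (auto simp: refl_on_def sym_def trans_def dest: rel_wterms
      intro: wgwa_rel.refl wgwa_rel.sym wgwa_rel.trans)

lemma class_eq_iff: "\<lbrakk>p \<in> wterms R; q \<in> wterms R\<rbrakk> \<Longrightarrow> cl p = cl q \<longleftrightarrow> (p, q) \<in> E"
  by (simp add: wgwa_class_def eq_equiv_class_iff[OF equiv_rel])

lemma class_eqI: "(p, q) \<in> E \<Longrightarrow> cl p = cl q"
  using class_eq_iff rel_wterms by blast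

lemma carrier_wgwa: "carrier A = cl ` wterms R"
  by (auto simp: wgwa_def wgwa_class_def quotient_def)

lemma add_wgwa: "\<lbrakk>p \<in> wterms R; q \<in> wterms R\<rbrakk> \<Longrightarrow> cl p \<oplus>\<^bsub>A\<^esub> cl q = cl (Plus p q)"
proof -
  assume pq: "p \<in> wterms R" "q \<in> wterms R"
  have "(\<lambda>p q. cl (Plus p q)) respects2 E"
    by (rule congruent2I') (intro class_eqI wgwa_rel.plus_cong)
  from UN_equiv_class2[OF equiv_rel equiv_rel this pq]
  show ?thesis by (simp add: wgwa_def wgwa_class_def)
qed

lemma mult_wgwa: "\<lbrakk>p \<in> wterms R; q \<in> wterms R\<rbrakk> \<Longrightarrow> cl p \<otimes>\<^bsub>A\<^esub> cl q = cl (Times p q)"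
proof -
  assume pq: "p \<in> wterms R" "q \<in> wterms R"
  have "(\<lambda>p q. cl (Times p q)) respects2 E"
    by (rule congruent2I') (intro class_eqI wgwa_rel.times_cong)
  from UN_equiv_class2[OF equiv_rel equiv_rel this pq]
  show ?thesis by (simp add: wgwa_def wgwa_class_def)
qed

lemma zero_wgwa: "\<zero>\<^bsub>A\<^esub> = cl (Scalar \<zero>)" and one_wgwa: "\<one>\<^bsub>A\<^esub> = cl (Scalar \<one>)"
  by (simp_all add: wgwa_def)

lemmas wgwa_ops = carrier_wgwa add_wgwa mult_wgwa zero_wgwa one_wgwa

lemma ring_wgwa: "ring A"
proof (rule ringI)
  show "abelian_group A"
  proof (rule abelian_groupI)
    fix x assume "x \<in> carrier A"
    then obtain p where "p \<in> wterms R" "x = cl p" by (auto simp: carrier_wgwa)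
    then show "\<exists>y\<in>carrier A. y \<oplus>\<^bsub>A\<^esub> x = \<zero>\<^bsub>A\<^esub>"
      by (intro bexI[of _ "cl (Neg p)"]) (auto simp: wgwa_ops class_eq_iff intro: wgwa_rel.plus_neg del: equalityI)
  qed (auto simp: wgwa_ops class_eq_iff intro:
        wgwa_rel.plus_assoc wgwa_rel.plus_comm wgwa_rel.plus_zero del: equalityI)
  show "monoid A"
    by (rule monoidI) (auto simp: wgwa_ops class_eq_iff intro:
        wgwa_rel.times_assoc wgwa_rel.times_one_left wgwa_rel.times_one_right del: equalityI)
qed (auto simp: wgwa_ops class_eq_iff intro:
      wgwa_rel.distrib_left wgwa_rel.distrib_right del: equalityI)

lemma scalar_hom: "wgwa_scalar R \<sigma> t \<in> ring_hom R A"
  by (rule ring_hom_memI) (auto simp: wgwa_scalar_def wgwa_ops class_eq_iff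
      intro: wgwa_rel.scalar_plus[THEN wgwa_rel.sym] wgwa_rel.scalar_times[THEN wgwa_rel.sym] del: equalityI)

lemma X_carrier: "wgwa_X R \<sigma> t \<in> carrier A" and Y_carrier: "wgwa_Y R \<sigma> t \<in> carrier A"
  by (auto simp: wgwa_X_def wgwa_Y_def carrier_wgwa)

lemma wgwa_relations:
  "wgwa_Y R \<sigma> t \<otimes>\<^bsub>A\<^esub> wgwa_X R \<sigma> t = wgwa_scalar R \<sigma> t t"
  "wgwa_X R \<sigma> t \<otimes>\<^bsub>A\<^esub> wgwa_Y R \<sigma> t = wgwa_scalar R \<sigma> t (\<sigma> t)"
  "r \<in> carrier R \<Longrightarrow>
    wgwa_X R \<sigma> t \<otimes>\<^bsub>A\<^esub> wgwa_scalar R \<sigma> t r = wgwa_scalar R \<sigma> t (\<sigma> r) \<otimes>\<^bsub>A\<^esub> wgwa_X R \<sigma> t"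
  "r \<in> carrier R \<Longrightarrow>
    wgwa_scalar R \<sigma> t r \<otimes>\<^bsub>A\<^esub> wgwa_Y R \<sigma> t = wgwa_Y R \<sigma> t \<otimes>\<^bsub>A\<^esub> wgwa_scalar R \<sigma> t (\<sigma> r)"
  using ring_hom_closed[OF sigma_hom] t_carrier
  by (auto simp: wgwa_X_def wgwa_Y_def wgwa_scalar_def mult_wgwa class_eq_iff
      intro: wgwa_rel.YX wgwa_rel.XY wgwa_rel.Xr wgwa_rel.rY del: equalityI)

end

text \<open>The algebra has the universal property of the ring given by the presentation.\<close>

primrec wterm_eval ::
  "('b, 'u) ring_scheme \<Rightarrow> ('r \<Rightarrow> 'b) \<Rightarrow> 'b \<Rightarrow> 'b \<Rightarrow> 'r wterm \<Rightarrow> 'b"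
  where
  "wterm_eval B \<phi> x y (Scalar r) = \<phi> r"
| "wterm_eval B \<phi> x y GenX = x"
| "wterm_eval B \<phi> x y GenY = y"
| "wterm_eval B \<phi> x y (Plus p q) = wterm_eval B \<phi> x y p \<oplus>\<^bsub>B\<^esub> wterm_eval B \<phi> x y q"
| "wterm_eval B \<phi> x y (Times p q) = wterm_eval B \<phi> x y p \<otimes>\<^bsub>B\<^esub> wterm_eval B \<phi> x y q"
| "wterm_eval B \<phi> x y (Neg p) = \<ominus>\<^bsub>B\<^esub> wterm_eval B \<phi> x y p"

context wgwa_data
begin

theorem wgwa_universal:
  fixes B (structure)
  assumes B: "ring B" and \<phi>: "\<phi> \<in> ring_hom R B"
    and xy: "x \<in> carrier B" "y \<in> carrier B"
    and rels: "y \<otimes>\<^bsub>B\<^esub> x = \<phi> t" "x \<otimes>\<^bsub>B\<^esub> y = \<phi> (\<sigma> t)"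
      "\<And>r. r \<in> carrier R \<Longrightarrow> x \<otimes>\<^bsub>B\<^esub> \<phi> r = \<phi> (\<sigma> r) \<otimes>\<^bsub>B\<^esub> x"
      "\<And>r. r \<in> carrier R \<Longrightarrow> \<phi> r \<otimes>\<^bsub>B\<^esub> y = y \<otimes>\<^bsub>B\<^esub> \<phi> (\<sigma> r)"
  shows "\<exists>!h. h \<in> ring_hom A B \<and> h \<in> extensional (carrier A) \<and>
    (\<forall>r\<in>carrier R. h (wgwa_scalar R \<sigma> t r) = \<phi> r) \<and>
    h (wgwa_X R \<sigma> t) = x \<and> h (wgwa_Y R \<sigma> t) = y"
proof -
  interpret B: ring B by fact
  interpret A: ring A by (rule ring_wgwa)
  let ?e = "wterm_eval B \<phi> x y"
  have closed: "?e p \<in> carrier B" if "p \<in> wterms R" for p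
    using that by (induction p) (use xy ring_hom_closed[OF \<phi>] in auto)
  have phi0: "\<phi> \<zero>\<^bsub>R\<^esub> = \<zero>\<^bsub>B\<^esub>"
    using ring_hom_zero[OF \<phi>] B ring_axioms by blast
  have resp: "?e p = ?e q" if "(p, q) \<in> E" for p q
    using that
  proof (induction rule: wgwa_rel.induct)
    case (plus_comm p q) then show ?case by (simp add: closed B.a_comm)
  qed (auto simp: closed rels phi0 ring_hom_one[OF \<phi>] ring_hom_add[OF \<phi>] ring_hom_mult[OF \<phi>]
      B.a_assoc B.m_assoc B.l_distr B.r_distr B.l_neg)
  define h where "h = restrict (\<lambda>P. ?e (SOME p. p \<in> P)) (carrier A)"
  have h: "h (cl p) = ?e p" if "p \<in> wterms R" for p
  proof -
    have "p \<in> cl p" using that by (simp add: wgwa_class_def wgwa_rel.refl)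
    then have "(SOME p'. p' \<in> cl p) \<in> cl p" by (rule someI)
    then have "?e (SOME p'. p' \<in> cl p) = ?e p"
      using resp by (auto simp: wgwa_class_def)
    then show ?thesis using that by (simp add: h_def carrier_wgwa)
  qed
  have hom: "h \<in> ring_hom A B"
    by (rule ring_hom_memI)
      (auto simp: wgwa_ops h closed ring_hom_one[OF \<phi>])
  show ?thesis
  proof (rule ex1I[of _ h], intro conjI ballI)
    show "h \<in> extensional (carrier A)" by (simp add: h_def)
    fix g
    assume g: "g \<in> ring_hom A B \<and> g \<in> extensional (carrier A) \<and>
      (\<forall>r\<in>carrier R. g (wgwa_scalar R \<sigma> t r) = \<phi> r) \<and>
      g (wgwa_X R \<sigma> t) = x \<and> g (wgwa_Y R \<sigma> t) = y"
    then have ghom: "g \<in> ring_hom A B" by blast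
    have "g (cl p) = ?e p" if "p \<in> wterms R" for p
      using that
    proof (induction p)
      case (Plus p q)
      then have "g (cl p \<oplus>\<^bsub>A\<^esub> cl q) = g (cl p) \<oplus>\<^bsub>B\<^esub> g (cl q)"
        by (intro ring_hom_add[OF ghom]) (auto simp: carrier_wgwa)
      then show ?case using Plus by (simp add: add_wgwa)
    next
      case (Times p q)
      then have "g (cl p \<otimes>\<^bsub>A\<^esub> cl q) = g (cl p) \<otimes>\<^bsub>B\<^esub> g (cl q)"
        by (intro ring_hom_mult[OF ghom]) (auto simp: carrier_wgwa)
      then show ?case using Times by (simp add: mult_wgwa)
    next
      case (Neg p)
      then have p: "p \<in> wterms R" "cl p \<in> carrier A" "cl (Neg p) \<in> carrier A"
        by (auto simp: carrier_wgwa)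
      have "cl (Neg p) \<oplus>\<^bsub>A\<^esub> cl p = \<zero>\<^bsub>A\<^esub>"
        using p by (auto simp: wgwa_ops class_eq_iff intro: wgwa_rel.plus_neg del: equalityI)
      then have "g (cl (Neg p)) \<oplus>\<^bsub>B\<^esub> g (cl p) = g \<zero>\<^bsub>A\<^esub>"
        using ring_hom_add[OF ghom p(3) p(2)] by simp
      also have "\<dots> = \<zero>\<^bsub>B\<^esub>"
        using ring_hom_zero[OF ghom] B ring_wgwa by blast
      finally have "g (cl (Neg p)) \<oplus>\<^bsub>B\<^esub> g (cl p) = \<zero>\<^bsub>B\<^esub>" .
      then have "g (cl (Neg p)) = \<ominus>\<^bsub>B\<^esub> g (cl p)"
        using p ring_hom_closed[OF ghom] B.minus_equality by metis
      then show ?case using Neg p by simp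
    qed (use g in \<open>auto simp: wgwa_scalar_def wgwa_X_def wgwa_Y_def\<close>)
    then show "g = h"
      using g h by (intro extensionalityI[of _ "carrier A"]) (auto simp: h_def carrier_wgwa)
  qed (use hom h in \<open>auto simp: wgwa_scalar_def wgwa_X_def wgwa_Y_def\<close>)
qed

end


section \<open>Left modules over a ring\<close>

text \<open>The library's locale \<^locale>\<open>module\<close> demands a commutative ring of scalars.\<close>

locale left_module = A?: ring A + M?: abelian_group M for A (structure) and M (structure) +
  assumes smult_closed [simp, intro]:
      "\<lbrakk>a \<in> carrier A; v \<in> carrier M\<rbrakk> \<Longrightarrow> a \<odot>\<^bsub>M\<^esub> v \<in> carrier M"
    and smult_l_distr:
      "\<lbrakk>a \<in> carrier A; b \<in> carrier A; v \<in> carrier M\<rbrakk> \<Longrightarrow>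
      (a \<oplus> b) \<odot>\<^bsub>M\<^esub> v = a \<odot>\<^bsub>M\<^esub> v \<oplus>\<^bsub>M\<^esub> b \<odot>\<^bsub>M\<^esub> v"
    and smult_r_distr:
      "\<lbrakk>a \<in> carrier A; v \<in> carrier M; w \<in> carrier M\<rbrakk> \<Longrightarrow>
      a \<odot>\<^bsub>M\<^esub> (v \<oplus>\<^bsub>M\<^esub> w) = a \<odot>\<^bsub>M\<^esub> v \<oplus>\<^bsub>M\<^esub> a \<odot>\<^bsub>M\<^esub> w"
    and smult_assoc1:
      "\<lbrakk>a \<in> carrier A; b \<in> carrier A; v \<in> carrier M\<rbrakk> \<Longrightarrow>
      (a \<otimes> b) \<odot>\<^bsub>M\<^esub> v = a \<odot>\<^bsub>M\<^esub> (b \<odot>\<^bsub>M\<^esub> v)"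
    and smult_one [simp]:
      "v \<in> carrier M \<Longrightarrow> \<one> \<odot>\<^bsub>M\<^esub> v = v"

definition simple_left_module :: "('a, 's) ring_scheme \<Rightarrow> ('a, 'm, 'u) module_scheme \<Rightarrow> bool"
  where "simple_left_module A M \<longleftrightarrow>
    left_module A M \<and> carrier M \<noteq> {\<zero>\<^bsub>M\<^esub>} \<and>
    (\<forall>N. submodule N A M \<longrightarrow> N = {\<zero>\<^bsub>M\<^esub>} \<or> N = carrier M)"


section \<open>Weight modules\<close>

definition Max_ideals :: "('r, 's) ring_scheme \<Rightarrow> 'r set set"
  where "Max_ideals R = {\<mm>. maximalideal \<mm> R}"

definition weight_space :: "('r, 's) ring_scheme \<Rightarrow> ('r \<Rightarrow> 'r) \<Rightarrow> 'r \<Rightarrow>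
    ('r wterm set, 'm, 'u) module_scheme \<Rightarrow> 'r set \<Rightarrow> 'm set"
  where "weight_space R \<sigma> t M \<mm> =
    {v \<in> carrier M. \<forall>r\<in>\<mm>. wgwa_scalar R \<sigma> t r \<odot>\<^bsub>M\<^esub> v = \<zero>\<^bsub>M\<^esub>}"

text \<open>
  Internal direct sum: every vector is, in exactly one way, a finitely supported sum of vectors
  of the weight spaces.
\<close>

definition weight_module :: "('r, 's) ring_scheme \<Rightarrow> ('r \<Rightarrow> 'r) \<Rightarrow> 'r \<Rightarrow>
    ('r wterm set, 'm, 'u) module_scheme \<Rightarrow> bool"
  where "weight_module R \<sigma> t M \<longleftrightarrow>
    left_module (wgwa R \<sigma> t) M \<and>
    (\<forall>v\<in>carrier M. \<exists>!f. f \<in> (\<Pi>\<^sub>E \<mm>\<in>Max_ideals R. weight_space R \<sigma> t M \<mm>) \<and>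
      finite {\<mm> \<in> Max_ideals R. f \<mm> \<noteq> \<zero>\<^bsub>M\<^esub>} \<and>
      v = finsum M f {\<mm> \<in> Max_ideals R. f \<mm> \<noteq> \<zero>\<^bsub>M\<^esub>})"

definition weight_supp :: "('r, 's) ring_scheme \<Rightarrow> ('r \<Rightarrow> 'r) \<Rightarrow> 'r \<Rightarrow>
    ('r wterm set, 'm, 'u) module_scheme \<Rightarrow> 'r set set"
  where "weight_supp R \<sigma> t M = {\<mm> \<in> Max_ideals R. weight_space R \<sigma> t M \<mm> \<noteq> {\<zero>\<^bsub>M\<^esub>}}"

text \<open>
  The canonical inclusion of \<open>\<sigma>(R)/(\<sigma>(R) \<inter> \<mm>)\<close> into \<open>R/\<mm>\<close> maps the coset
  \<open>C = (\<sigma>(R) \<inter> \<mm>) + a\<close> to \<open>\<mm> + C = \<mm> + a\<close>.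
\<close>

definition essential_endo :: "('r, 's) ring_scheme \<Rightarrow> ('r \<Rightarrow> 'r) \<Rightarrow> bool"
  where "essential_endo R \<sigma> \<longleftrightarrow>
    (\<forall>\<mm>\<in>Max_ideals R.
      (\<lambda>C. \<mm> <+>\<^bsub>R\<^esub> C) `
        carrier (R\<lparr>carrier := \<sigma> ` carrier R\<rparr> Quot (\<sigma> ` carrier R \<inter> \<mm>))
      = carrier (R Quot \<mm>))"


section \<open>Chains of maximal ideals\<close>

text \<open>A family with index set \<open>I \<subseteq> \<int>\<close> is represented by \<open>I\<close> together with a function on \<open>I\<close>.\<close>

definition max_chains :: "('r, 's) ring_scheme \<Rightarrow> ('r \<Rightarrow> 'r) \<Rightarrow> int set \<Rightarrow> (int \<Rightarrow> 'r set) set"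
  where "max_chains R \<sigma> I =
    {m \<in> I \<rightarrow>\<^sub>E Max_ideals R. \<forall>i. i \<in> I \<and> i + 1 \<in> I \<longrightarrow> \<sigma> ` m i \<subseteq> m (i + 1)}"

definition Q_biinf :: "('r, 's) ring_scheme \<Rightarrow> ('r \<Rightarrow> 'r) \<Rightarrow> (int set \<times> (int \<Rightarrow> 'r set)) set"
  where "Q_biinf R \<sigma> = {(I, m). I = UNIV \<and> m \<in> max_chains R \<sigma> I}"

definition Q_right :: "('r, 's) ring_scheme \<Rightarrow> ('r \<Rightarrow> 'r) \<Rightarrow> 'r \<Rightarrow> (int set \<times> (int \<Rightarrow> 'r set)) set"
  where "Q_right R \<sigma> t = {(I, m). I = {0..} \<and> m \<in> max_chains R \<sigma> I \<and> \<sigma> t \<in> m 0}"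

definition Q_left :: "('r, 's) ring_scheme \<Rightarrow> ('r \<Rightarrow> 'r) \<Rightarrow> 'r \<Rightarrow> (int set \<times> (int \<Rightarrow> 'r set)) set"
  where "Q_left R \<sigma> t = {(I, m). I = {..0} \<and> m \<in> max_chains R \<sigma> I \<and> t \<in> m 0}"

definition Q_fin :: "('r, 's) ring_scheme \<Rightarrow> ('r \<Rightarrow> 'r) \<Rightarrow> 'r \<Rightarrow> nat \<Rightarrow>
    (int set \<times> (int \<Rightarrow> 'r set)) set"
  where "Q_fin R \<sigma> t n =
    {(I, m). I = {0..int n} \<and> m \<in> max_chains R \<sigma> I \<and> \<sigma> t \<in> m 0 \<and> t \<in> m (int n)}"

end

theory Submission
  imports Defs
begin

text \<open>
  Since \<open>\<sigma>\<close> is essential, \<open>\<tau>(\<mm>) = \<sigma>\<^sup>-\<^sup>1(\<mm>)\<close> maps maximal ideals to maximal ideals, \<open>Y\<close> maps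
  \<open>M\<^sub>\<mm>\<close> into \<open>M\<^sub>\<tau>\<^sub>(\<^sub>\<mm>\<^sub>)\<close>, and \<open>X\<close> maps \<open>M\<^sub>\<mm>\<close> into the sum of the \<open>M\<^sub>\<nn>\<close> with \<open>\<tau>(\<nn>) = \<mm>\<close>.
  Fix \<open>\<mm>\<close> in the support and let \<open>K\<close> be the sum of the \<open>M\<^sub>\<nn>\<close> over all \<open>\<nn>\<close> with \<open>\<mm>\<close> in their
  \<open>\<tau>\<close>-orbit. As \<open>XY = \<sigma>(t)\<close>, the sum of the \<open>Y\<^sup>i K\<close> is a nonzero submodule, hence all of \<open>M\<close>; so any
  two elements of the support are comparable, that is, one lies in the \<open>\<tau>\<close>-orbit of the other.
  Such a set is covered by a chain, which can always be continued to the left by \<open>\<tau>\<close>.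
  It only fails to continue to the right at some \<open>\<mm>\<close> in the support that is not of the form
  \<open>\<tau>(\<nn>)\<close> with \<open>\<nn>\<close> in the support; then \<open>X\<close> kills \<open>M\<^sub>\<mm>\<close>, so \<open>t = YX\<close> does, and \<open>t \<in> \<mm>\<close>.
  Hence a doubly infinite or a left infinite family always suffices.
\<close>

section \<open>Chains covering a set of pairwise comparable points of a self-map\<close>

lemma funpow_funpow: "(f ^^ m) ((f ^^ n) x) = (f ^^ (m + n)) x"
  by (simp add: funpow_add)

lemma funpow_fixpoint_mult: "(f ^^ n) x = x \<Longrightarrow> (f ^^ (n * k)) x = x"
  by (induction k) (simp_all add: funpow_add)

text \<open>If no \<open>T\<close>-point has all of \<open>S\<close> in its orbit, suitable points
  of the forward closure of \<open>S\<close> can be lifted along \<open>\<tau>\<close> again and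
  again; the lifts and the orbit of the starting point make up \<open>c\<close>. The delicate point
  is that the lifts must not circle in a cycle while parts of \<open>S\<close> lie outside
  it.\<close>

lemma comparable_orbit_cover:
  fixes \<tau> :: "'a \<Rightarrow> 'a" and S :: "'a set" and T :: "'a \<Rightarrow> bool"
  assumes nonempty: "S \<noteq> {}"
    and comparable: "\<And>a b. a \<in> S \<Longrightarrow> b \<in> S \<Longrightarrow> \<exists>k. (\<tau> ^^ k) a = b \<or> (\<tau> ^^ k) b = a"
    and preimage: "\<And>s. s \<in> S \<Longrightarrow> \<not> T s \<Longrightarrow> \<exists>n\<in>S. \<tau> n = s"
  shows "(\<exists>s\<in>S. T s \<and> S \<subseteq> (\<lambda>k. (\<tau> ^^ k) s) ` UNIV) \<or>
    (\<exists>c::int \<Rightarrow> 'a. (\<forall>i. \<tau> (c (i + 1)) = c i) \<and> S \<subseteq> range c \<and>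
      range c \<subseteq> {(\<tau> ^^ k) s |k s. s \<in> S})"
proof (rule disjCI)
  assume no_top: "\<not> (\<exists>c::int \<Rightarrow> 'a. (\<forall>i. \<tau> (c (i + 1)) = c i) \<and> S \<subseteq> range c \<and>
      range c \<subseteq> {(\<tau> ^^ k) s |k s. s \<in> S})"
  \<comment> \<open>Only a preorder: the points of a \<open>\<tau>\<close>-cycle are below each
    other, so periodic points need separate care.\<close>
  define below where "below a b \<longleftrightarrow> (\<exists>k. (\<tau> ^^ k) b = a)" for a b
  \<comment> \<open>Orbit points between two elements of \<open>S\<close> need not lie in
    \<open>S\<close>, but a chain has to pass through them.\<close>
  define D where "D = {(\<tau> ^^ k) s |k s. s \<in> S}"
  have below_refl: "below a a" for a
    unfolding below_def by (rule exI[of _ 0]) simp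
  have below_trans: "below a c" if "below a b" "below b c" for a b c
    using that unfolding below_def by (auto simp: funpow_funpow)
  have SD: "s \<in> D" if "s \<in> S" for s
    unfolding D_def using that by (intro CollectI exI[of _ 0] exI[of _ s]) simp
  have D_orbit: "(\<tau> ^^ k) d \<in> D" if "d \<in> D" for k d
    using that funpow_funpow[of k \<tau>] unfolding D_def by blast
  have orbit_comparable: "below ((\<tau> ^^ k) s) ((\<tau> ^^ l) s) \<or> below ((\<tau> ^^ l) s) ((\<tau> ^^ k) s)" for k l s
  proof (cases "k \<le> l")
    case True
    then have "(\<tau> ^^ l) s = (\<tau> ^^ (l - k)) ((\<tau> ^^ k) s)"
      by (simp add: funpow_funpow)
    then show ?thesis by (auto simp: below_def)
  next
    case False
    then have "(\<tau> ^^ k) s = (\<tau> ^^ (k - l)) ((\<tau> ^^ l) s)"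
      by (simp add: funpow_funpow)
    then show ?thesis by (auto simp: below_def)
  qed
  have D_comparable: "below a b \<or> below b a" if ab: "a \<in> D" "b \<in> D" for a b
  proof -
    obtain k l s s' where *: "a = (\<tau> ^^ k) s" "b = (\<tau> ^^ l) s'" "s \<in> S" "s' \<in> S"
      using ab by (auto simp: D_def)
    obtain j where "(\<tau> ^^ j) s = s' \<or> (\<tau> ^^ j) s' = s" using comparable * by blast
    then show ?thesis
    proof
      assume "(\<tau> ^^ j) s = s'"
      then have "b = (\<tau> ^^ (l + j)) s" using * by (simp add: funpow_add)
      then show ?thesis using * orbit_comparable by blast
    next
      assume "(\<tau> ^^ j) s' = s"
      then have "a = (\<tau> ^^ (k + j)) s'" using * by (simp add: funpow_add)
      then show ?thesis using * orbit_comparable by blast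
    qed
  qed
  define per where "per m \<longleftrightarrow> (\<exists>k. (\<tau> ^^ Suc k) m = m)" for m
  have per_orbit: "per ((\<tau> ^^ i) m)" if m: "per m" for i m
  proof -
    obtain k where k: "(\<tau> ^^ Suc k) m = m" using m unfolding per_def by (rule exE)
    have "(\<tau> ^^ Suc k) ((\<tau> ^^ i) m) = (\<tau> ^^ i) ((\<tau> ^^ Suc k) m)"
      by (simp only: funpow_funpow add.commute)
    then have "(\<tau> ^^ Suc k) ((\<tau> ^^ i) m) = (\<tau> ^^ i) m"
      unfolding k .
    then show ?thesis unfolding per_def by (rule exI)
  qed
  show "\<exists>s\<in>S. T s \<and> S \<subseteq> (\<lambda>k. (\<tau> ^^ k) s) ` UNIV"
  proof (rule ccontr)
    assume no: "\<not> ?thesis"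
    \<comment> \<open>The points from which lifting may go on: nonperiodic ones, unless all of
      \<open>D\<close> is periodic. A walk that stands on a cycle could circle for ever and miss
      nonperiodic points above it.\<close>
    define P where "P m \<longleftrightarrow> m \<in> D \<and> (per m \<longrightarrow> (\<forall>d\<in>D. per d))" for m
    have PI: "\<exists>n. P n \<and> \<tau> n = m" if "P m" "n \<in> D" "\<tau> n = m" for m n
    proof -
      \<comment> \<open>\<open>\<tau>\<close> preserves periodicity, so a lift of a nonperiodic
        point is again nonperiodic.\<close>
      have "per n \<Longrightarrow> per m" using per_orbit[of n 1] that(3) by simp
      then have "P n" using that(1,2) unfolding P_def by blast
      then show ?thesis using that(3) by blast
    qed
    have step: "\<exists>n. P n \<and> \<tau> n = m" if m: "P m" for m
    proof (cases "per m")
      case True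
      then obtain k where "(\<tau> ^^ Suc k) m = m" unfolding per_def by (rule exE)
      then have "\<tau> ((\<tau> ^^ k) m) = m" by simp
      moreover have "(\<tau> ^^ k) m \<in> D" using m D_orbit by (auto simp: P_def)
      ultimately show ?thesis by (intro PI[OF m])
    next
      case False
      \<comment> \<open>The orbit of \<open>d\<close> reaches \<open>m\<close> after a positive
        number of steps; the point just before is the lift.\<close>
      have above: "\<exists>n. P n \<and> \<tau> n = m" if d: "d \<in> D" "below m d" "d \<noteq> m" for d
      proof -
        obtain k where k: "(\<tau> ^^ k) d = m" using d by (auto simp: below_def)
        with d obtain j where "k = Suc j" by (cases k) auto
        then have "\<tau> ((\<tau> ^^ j) d) = m" using k by simp
        then show ?thesis by (rule PI[OF m D_orbit[OF d(1)]])
      qed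
      show ?thesis
      proof (cases "m \<in> S")
        case mS: True
        show ?thesis
        proof (cases "T m")
          case True
          \<comment> \<open>By \<open>no\<close>, the orbit of the \<open>T\<close>-point
            \<open>m\<close> misses some element of \<open>S\<close>; comparability puts that
            element above \<open>m\<close>.\<close>
          then obtain d where d: "d \<in> S" "\<not> below d m" using no mS unfolding below_def by blast
          then have "below m d" "d \<noteq> m" using D_comparable SD mS below_refl by blast+
          then show ?thesis using above[of d] SD d by blast
        next
          case False
          then obtain n where "n \<in> S" "\<tau> n = m" using preimage mS by blast
          then show ?thesis using PI[OF m] SD by blast
        qed
      next
        case False
        obtain i s where s: "s \<in> S" "m = (\<tau> ^^ i) s" using m by (auto simp: P_def D_def)
        then have "below m s" by (auto simp: below_def)
        moreover have "s \<noteq> m" using s False by blast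
        ultimately show ?thesis using above[of s] SD[OF s(1)] by blast
      qed
    qed
    obtain m0 where m0: "P m0"
    proof (cases "\<forall>d\<in>D. per d")
      case True
      then show ?thesis using that nonempty SD unfolding P_def by blast
    next
      case False
      then show ?thesis using that by (auto simp: P_def)
    qed
    have "\<exists>a. \<forall>n. P (a n) \<and> \<tau> (a (Suc n)) = a n"
      by (rule dependent_nat_choice) (use m0 step in blast)+
    then obtain a where a: "\<And>n. P (a n)" "\<And>n. \<tau> (a (Suc n)) = a n" by blast
    have aD: "a n \<in> D" for n using a(1) by (auto simp: P_def)
    have orbit_a: "(\<tau> ^^ k) (a n) = (if k \<le> n then a (n - k) else (\<tau> ^^ (k - n)) (a 0))" for k n
    proof (induction k)
      case (Suc k)
      show ?case
      proof (cases "Suc k \<le> n")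
        case True
        then have "\<tau> (a (n - k)) = a (n - Suc k)"
          using a(2)[of "n - Suc k"] by (simp add: Suc_diff_Suc)
        then show ?thesis using Suc True by simp
      next
        case False
        then have "Suc k - n = Suc (k - n)" by simp
        then show ?thesis using Suc False by auto
      qed
    qed simp
    \<comment> \<open>Induction on the number \<open>k\<close> of steps from \<open>d\<close> down
      to the chain: comparing \<open>d\<close> with the next point \<open>a (Suc n)\<close> settles
      the claim, shortens the distance, or exhibits a cycle.\<close>
    have reach: "\<exists>j. below d (a j)" if "(\<tau> ^^ k) d = a n" "d \<in> D" for d k n
      using that
    proof (induction k arbitrary: n rule: less_induct)
      case (less k)
      show ?case
      proof (cases "below d (a (Suc n)) \<or> below d (a n)")
        case False
        then obtain i where i: "(\<tau> ^^ i) d = a (Suc n)"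
          using D_comparable[OF less.prems(2) aD[of "Suc n"]] by (auto simp: below_def)
        show ?thesis
        proof (cases "i < k")
          case True
          then show ?thesis using less.IH i less.prems by blast
        next
          case ge: False
          \<comment> \<open>On its way to \<open>a (Suc n)\<close> the orbit of \<open>d\<close> has
            already met \<open>a n\<close>, so both chain points lie on one cycle. Then
            \<open>P\<close> makes \<open>d\<close> periodic too, say with period
            \<open>Suc p\<close>; after the \<open>k\<close> steps to \<open>a n\<close>, another
            \<open>p * k\<close> steps lead back to \<open>d\<close>.\<close>
          have "(\<tau> ^^ Suc (i - k)) (a n) = \<tau> ((\<tau> ^^ (i - k)) ((\<tau> ^^ k) d))"
            using less.prems by simp
          also have "(\<tau> ^^ (i - k)) ((\<tau> ^^ k) d) = (\<tau> ^^ i) d"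
            using ge by (simp add: funpow_funpow)
          finally have "(\<tau> ^^ Suc (i - k)) (a n) = a n" using i a(2) by simp
          then have pern: "per (a n)" unfolding per_def by (rule exI)
          then have "per d" using a(1)[of n] less.prems unfolding P_def by blast
          then obtain p where p: "(\<tau> ^^ Suc p) d = d" unfolding per_def by (rule exE)
          have "(\<tau> ^^ (Suc p * k)) d = d" by (rule funpow_fixpoint_mult[OF p])
          moreover have "Suc p * k = p * k + k" by (simp only: mult_Suc add.commute)
          ultimately have "(\<tau> ^^ (p * k)) (a n) = d"
            using less.prems(1) by (simp only: funpow_funpow flip: less.prems(1))
          then show ?thesis by (auto simp: below_def)
        qed
      qed blast
    qed
    \<comment> \<open>Both formulas give \<open>a 0\<close> at index 0, which makes the seam at
      \<open>i = -1\<close> consistent.\<close>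
    define c :: "int \<Rightarrow> 'a"
      where "c i = (if 0 \<le> i then a (nat i) else (\<tau> ^^ nat (- i)) (a 0))" for i
    have "\<tau> (c (i + 1)) = c i" for i
    proof (cases "0 \<le> i")
      case True
      then show ?thesis using a(2) by (simp add: c_def nat_add_distrib)
    next
      case False
      then have "nat (- i) = Suc (nat (- (i + 1)))" by simp
      moreover have "c (i + 1) = (\<tau> ^^ nat (- (i + 1))) (a 0)"
        using False by (cases "i = -1") (auto simp: c_def)
      ultimately show ?thesis using False by (simp add: c_def)
    qed
    moreover have "S \<subseteq> range c"
    proof
      fix d assume "d \<in> S"
      then have d: "d \<in> D" by (rule SD)
      have "\<exists>j. below d (a j)"
      proof (cases "below d (a 0)")
        case False
        then obtain k where "(\<tau> ^^ k) d = a 0"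
          using D_comparable[OF d aD[of 0]] by (auto simp: below_def)
        then show ?thesis using reach d by blast
      qed blast
      then obtain j k where k: "(\<tau> ^^ k) (a j) = d" by (auto simp: below_def)
      show "d \<in> range c"
      proof (cases "k \<le> j")
        case True
        then have "d = c (int (j - k))" using k orbit_a[of k j] by (simp add: c_def nat_diff_distrib')
        then show ?thesis by blast
      next
        case False
        then have "d = c (- int (k - j))" using k orbit_a[of k j] by (simp add: c_def nat_diff_distrib')
        then show ?thesis by blast
      qed
    qed
    moreover have "range c \<subseteq> D"
      using aD D_orbit by (auto simp: c_def)
    ultimately show False using no_top unfolding D_def by blast
  qed
qed


section \<open>Maximal ideals and their preimages under \<open>\<sigma>\<close>\<close>

lemma Max_ideals_eqI:
  assumes "\<mm> \<in> Max_ideals R" "\<nn> \<in> Max_ideals R" "\<mm> \<subseteq> \<nn>"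
  shows "\<nn> = \<mm>"
proof -
  interpret m: maximalideal \<mm> R using assms by (simp add: Max_ideals_def)
  interpret n: maximalideal \<nn> R using assms by (simp add: Max_ideals_def)
  show ?thesis
    using m.I_maximal[OF n.is_ideal assms(3) n.a_subset] n.I_notcarr by blast
qed

context cring
begin

text \<open>The ideal \<open>\<mm> + (a)\<close> properly contains \<open>\<mm>\<close>, hence is
  all of \<open>R\<close>; so \<open>a\<close> has an inverse modulo \<open>\<mm>\<close>.\<close>

lemma maximalideal_unit_modulo:
  assumes "maximalideal \<mm> R" "a \<in> carrier R" "a \<notin> \<mm>"
  shows "\<exists>b\<in>carrier R. \<exists>x\<in>\<mm>. b \<otimes> a \<oplus> x = \<one>"
proof -
  interpret m: maximalideal \<mm> R by fact
  have "ideal (\<mm> <+>\<^bsub>R\<^esub> PIdl a) R"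
    by (intro add_ideals m.is_ideal cgenideal_ideal assms)
  moreover have "\<mm> \<subseteq> \<mm> <+>\<^bsub>R\<^esub> PIdl a"
  proof
    fix x assume x: "x \<in> \<mm>"
    have "\<zero> \<in> PIdl a" by (intro additive_subgroup.zero_closed ideal.axioms(1) cgenideal_ideal assms)
    moreover have "x = x \<oplus> \<zero>" using x m.a_Hcarr by simp
    ultimately show "x \<in> \<mm> <+>\<^bsub>R\<^esub> PIdl a" using x unfolding set_add_def' by blast
  qed
  moreover have "a \<in> \<mm> <+>\<^bsub>R\<^esub> PIdl a"
  proof -
    have "a = \<zero> \<oplus> a" using assms(2) by simp
    then show ?thesis
      using cgenideal_self[OF assms(2)] m.zero_closed unfolding set_add_def' by blast
  qed
  ultimately have "\<mm> <+>\<^bsub>R\<^esub> PIdl a = carrier R"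
    using m.I_maximal[of "\<mm> <+>\<^bsub>R\<^esub> PIdl a"] assms(3) ideal.axioms(1)[THEN additive_subgroup.a_subset]
    by blast
  then have "\<one> \<in> \<mm> <+>\<^bsub>R\<^esub> PIdl a" by simp
  then obtain x b where x: "x \<in> \<mm>" "b \<in> carrier R" "\<one> = x \<oplus> b \<otimes> a"
    unfolding set_add_def' cgenideal_def by blast
  then have "b \<otimes> a \<oplus> x = \<one>" using assms(2) m.a_Hcarr a_comm[of x "b \<otimes> a"] by simp
  then show ?thesis using x by blast
qed

text \<open>Each \<open>\<nn>\<close> in \<open>F\<close> has an element outside
  \<open>\<mm>\<close>, by maximality; the product of these stays outside because
  \<open>\<mm>\<close> is prime.\<close>

lemma maximalideal_avoidance:
  assumes "finite F" "F \<subseteq> Max_ideals R" "\<mm> \<in> Max_ideals R" "\<mm> \<notin> F"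
  shows "\<exists>a\<in>carrier R. a \<notin> \<mm> \<and> (\<forall>\<nn>\<in>F. a \<in> \<nn>)"
  using assms
proof (induction F rule: finite_induct)
  case empty
  interpret m: maximalideal \<mm> R using empty by (simp add: Max_ideals_def)
  have "\<one> \<notin> \<mm>" using m.one_imp_carrier m.I_notcarr by blast
  then show ?case by blast
next
  case (insert \<nn> F)
  then obtain a where a: "a \<in> carrier R" "a \<notin> \<mm>" "\<forall>\<nn>\<in>F. a \<in> \<nn>" by auto
  interpret m: primeideal \<mm> R
    using insert.prems maximalideal_prime by (simp add: Max_ideals_def)
  obtain c where c: "c \<in> \<nn>" "c \<notin> \<mm>"
    using insert.prems Max_ideals_eqI[of \<nn> R \<mm>] by blast
  have id: "ideal \<kk> R" if "\<kk> \<in> insert \<nn> F" for \<kk>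
    using insert.prems that by (auto simp: Max_ideals_def maximalideal_def)
  have cc: "c \<in> carrier R"
    using additive_subgroup.a_Hcarr[OF ideal.axioms(1)[OF id[of \<nn>]] c(1)] by simp
  have "a \<otimes> c \<notin> \<mm>" using m.I_prime a c cc by blast
  moreover have "a \<otimes> c \<in> \<kk>" if "\<kk> \<in> insert \<nn> F" for \<kk>
    using that id[OF that] a c cc by (auto intro: ideal.I_l_closed ideal.I_r_closed)
  ultimately show ?case using a cc by blast
qed

end

definition pullback :: "('r, 's) ring_scheme \<Rightarrow> ('r \<Rightarrow> 'r) \<Rightarrow> 'r set \<Rightarrow> 'r set"
  where "pullback R \<sigma> \<mm> = {r \<in> carrier R. \<sigma> r \<in> \<mm>}"

text \<open>Essentiality in the elementwise form \<open>R = \<mm> + \<sigma>(R)\<close>: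
  surjectivity of the canonical inclusion yields a coset \<open>C\<close> of some
  \<open>\<sigma> a\<close> that represents \<open>r\<close> modulo \<open>\<mm>\<close>.\<close>

lemma (in cring) essential_endo_decompose:
  assumes "essential_endo R \<sigma>" "\<sigma> \<in> ring_hom R R" "\<mm> \<in> Max_ideals R" "r \<in> carrier R"
  shows "\<exists>a\<in>carrier R. \<exists>x\<in>\<mm>. r = x \<oplus> \<sigma> a"
proof -
  interpret m: ideal \<mm> R using assms by (simp add: Max_ideals_def maximalideal_def)
  have "\<mm> +> r \<in> carrier (R Quot \<mm>)"
    using assms by (auto simp: FactRing_def A_RCOSETS_def')
  then obtain C where C: "C \<in> carrier (R\<lparr>carrier := \<sigma> ` carrier R\<rparr> Quot (\<sigma> ` carrier R \<inter> \<mm>))"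
    "\<mm> +> r = \<mm> <+>\<^bsub>R\<^esub> C"
    using assms unfolding essential_endo_def by blast
  obtain a where a: "a \<in> carrier R" "C = {x \<oplus> \<sigma> a |x. x \<in> \<sigma> ` carrier R \<inter> \<mm>}"
    using C(1) by (auto simp: FactRing_def A_RCOSETS_def' a_r_coset_def')
  have "r \<in> \<mm> +> r" using assms(4) m.a_rcos_self by blast
  then obtain y x where "y \<in> \<mm>" "x \<in> \<mm>" "r = y \<oplus> (x \<oplus> \<sigma> a)"
    unfolding C(2) a(2) set_add_def' by blast
  moreover have "\<sigma> a \<in> carrier R" using ring_hom_closed[OF assms(2)] a(1) by blast
  ultimately have "r = (y \<oplus> x) \<oplus> \<sigma> a" "y \<oplus> x \<in> \<mm>"
    by (auto simp: a_assoc m.a_Hcarr)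
  then show ?thesis using a(1) by blast
qed

text \<open>In general such a preimage is only prime. By essentiality, an inverse of
  \<open>\<sigma> a\<close> modulo \<open>\<mm>\<close> can be chosen in the image of
  \<open>\<sigma>\<close>, which inverts \<open>a\<close> modulo the pullback.\<close>

lemma (in cring) pullback_Max_ideals:
  assumes ess: "essential_endo R \<sigma>" and hom: "\<sigma> \<in> ring_hom R R" and m: "\<mm> \<in> Max_ideals R"
  shows "pullback R \<sigma> \<mm> \<in> Max_ideals R"
proof -
  interpret m: maximalideal \<mm> R using m by (simp add: Max_ideals_def)
  interpret h: ring_hom_ring R R \<sigma> using hom by (simp add: ring_hom_ringI2 ring_axioms)
  have one: "\<one> \<notin> \<mm>" using m.one_imp_carrier m.I_notcarr by blast
  have ideal: "ideal (pullback R \<sigma> \<mm>) R"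
  proof (rule idealI[OF ring_axioms])
    show "subgroup (pullback R \<sigma> \<mm>) (add_monoid R)"
      by (rule add.subgroupI) (auto simp: pullback_def m.zero_closed intro!: exI[of _ \<zero>] simp flip: a_inv_def)
  qed (auto simp: pullback_def intro: m.I_l_closed m.I_r_closed)
  have "maximalideal (pullback R \<sigma> \<mm>) R"
  proof (rule maximalidealI[OF ideal])
    show "carrier R \<noteq> pullback R \<sigma> \<mm>" using one by (force simp: pullback_def)
    fix J assume J: "ideal J R" "pullback R \<sigma> \<mm> \<subseteq> J" "J \<subseteq> carrier R"
    interpret J: ideal J R by fact
    show "J = pullback R \<sigma> \<mm> \<or> J = carrier R"
    proof (rule disjCI)
      assume "J \<noteq> carrier R"
      then have oneJ: "\<one> \<notin> J" using J.one_imp_carrier by blast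
      have "a \<in> pullback R \<sigma> \<mm>" if a: "a \<in> J" for a
      proof (rule ccontr)
        assume na: "a \<notin> pullback R \<sigma> \<mm>"
        have ac: "a \<in> carrier R" using a J by blast
        then have "\<sigma> a \<notin> \<mm>" using na by (simp add: pullback_def)
        then obtain b x where b: "b \<in> carrier R" "x \<in> \<mm>" "b \<otimes> \<sigma> a \<oplus> x = \<one>"
          using maximalideal_unit_modulo[OF m.is_maximalideal] ac by (meson h.hom_closed)
        obtain c y where c: "c \<in> carrier R" "y \<in> \<mm>" "b = y \<oplus> \<sigma> c"
          using essential_endo_decompose[OF ess hom m b(1)] by blast
        note car = ac b(1) c(1) m.a_Hcarr[OF b(2)] m.a_Hcarr[OF c(2)] h.hom_closed[OF ac] h.hom_closed[OF c(1)]
        \<comment> \<open>After \<open>\<sigma> c \<otimes> \<sigma> a\<close> cancels, only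
          multiples of \<open>x\<close> and \<open>y\<close> remain, and these lie in
          \<open>\<mm>\<close>. So \<open>c\<close> inverts \<open>a\<close> modulo the pullback,
          and then modulo \<open>J\<close>.\<close>
        have "\<sigma> (\<one> \<ominus> c \<otimes> a) = (b \<otimes> \<sigma> a \<oplus> x) \<ominus> \<sigma> c \<otimes> \<sigma> a"
          using b(3) ac c(1) by (simp add: a_minus_def)
        also have "\<dots> = y \<otimes> \<sigma> a \<oplus> x"
          unfolding c(3) using car by algebra
        also have "\<dots> \<in> \<mm>" using b(2) c(2) car by (simp add: m.I_r_closed)
        finally have "\<one> \<ominus> c \<otimes> a \<in> J"
          using ac c(1) J(2) by (auto simp: pullback_def)
        moreover have "c \<otimes> a \<in> J" using a c(1) by (rule J.I_l_closed)
        ultimately have "(\<one> \<ominus> c \<otimes> a) \<oplus> c \<otimes> a \<in> J" by simp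
        moreover have "(\<one> \<ominus> c \<otimes> a) \<oplus> c \<otimes> a = \<one>" using ac c(1) by algebra
        ultimately show False using oneJ by simp
      qed
      then show "J = pullback R \<sigma> \<mm>" using J(2) by blast
    qed
  qed
  then show ?thesis by (simp add: Max_ideals_def)
qed


section \<open>Modules over the algebra, seen through the action of scalars, \<open>X\<close> and
  \<open>Y\<close>\<close>

locale wgwa_module = wgwa_data R \<sigma> t + Mod: left_module "wgwa R \<sigma> t" M
  for R (structure) and \<sigma> t and M (structure)
begin

abbreviation scale :: "'a \<Rightarrow> 'c \<Rightarrow> 'c"
  where "scale r v \<equiv> wgwa_scalar R \<sigma> t r \<odot>\<^bsub>M\<^esub> v"

abbreviation X_act :: "'c \<Rightarrow> 'c"
  where "X_act v \<equiv> wgwa_X R \<sigma> t \<odot>\<^bsub>M\<^esub> v"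

abbreviation Y_act :: "'c \<Rightarrow> 'c"
  where "Y_act v \<equiv> wgwa_Y R \<sigma> t \<odot>\<^bsub>M\<^esub> v"

abbreviation weight :: "'a set \<Rightarrow> 'c set"
  where "weight \<mm> \<equiv> weight_space R \<sigma> t M \<mm>"

lemma sigma_closed: "r \<in> carrier R \<Longrightarrow> \<sigma> r \<in> carrier R"
  by (rule ring_hom_closed[OF sigma_hom])

lemma scalar_closed: "r \<in> carrier R \<Longrightarrow> wgwa_scalar R \<sigma> t r \<in> carrier A"
  by (rule ring_hom_closed[OF scalar_hom])

lemma smult_r_null: "a \<in> carrier A \<Longrightarrow> a \<odot>\<^bsub>M\<^esub> \<zero>\<^bsub>M\<^esub> = \<zero>\<^bsub>M\<^esub>"
  by (metis Mod.M.add.l_cancel_one Mod.M.l_zero Mod.M.zero_closed Mod.smult_closed Mod.smult_r_distr)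

lemma smult_l_null: "v \<in> carrier M \<Longrightarrow> \<zero>\<^bsub>A\<^esub> \<odot>\<^bsub>M\<^esub> v = \<zero>\<^bsub>M\<^esub>"
  by (metis Mod.A.l_zero Mod.A.zero_closed Mod.M.add.l_cancel_one Mod.smult_closed Mod.smult_l_distr)

lemma smult_l_minus:
  assumes "a \<in> carrier A" "v \<in> carrier M"
  shows "(\<ominus>\<^bsub>A\<^esub> a) \<odot>\<^bsub>M\<^esub> v = \<ominus>\<^bsub>M\<^esub> (a \<odot>\<^bsub>M\<^esub> v)"
proof -
  have "(\<ominus>\<^bsub>A\<^esub> a) \<odot>\<^bsub>M\<^esub> v \<oplus>\<^bsub>M\<^esub> a \<odot>\<^bsub>M\<^esub> v = \<zero>\<^bsub>M\<^esub>"
    using assms by (simp add: Mod.A.l_neg smult_l_null flip: Mod.smult_l_distr)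
  then show ?thesis using assms by (metis Mod.A.a_inv_closed Mod.M.minus_equality Mod.smult_closed)
qed

lemma act_closed:
  assumes "v \<in> carrier M"
  shows "r \<in> carrier R \<Longrightarrow> scale r v \<in> carrier M"
    and "X_act v \<in> carrier M" "Y_act v \<in> carrier M"
  using assms scalar_closed X_carrier Y_carrier by auto

lemma act_add:
  assumes "v \<in> carrier M" "w \<in> carrier M"
  shows "r \<in> carrier R \<Longrightarrow> scale r (v \<oplus>\<^bsub>M\<^esub> w) = scale r v \<oplus>\<^bsub>M\<^esub> scale r w"
    and "X_act (v \<oplus>\<^bsub>M\<^esub> w) = X_act v \<oplus>\<^bsub>M\<^esub> X_act w"
    and "Y_act (v \<oplus>\<^bsub>M\<^esub> w) = Y_act v \<oplus>\<^bsub>M\<^esub> Y_act w"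
  using assms scalar_closed X_carrier Y_carrier by (simp_all add: Mod.smult_r_distr)

lemma act_zero:
  "r \<in> carrier R \<Longrightarrow> scale r \<zero>\<^bsub>M\<^esub> = \<zero>\<^bsub>M\<^esub>" "X_act \<zero>\<^bsub>M\<^esub> = \<zero>\<^bsub>M\<^esub>" "Y_act \<zero>\<^bsub>M\<^esub> = \<zero>\<^bsub>M\<^esub>"
  using scalar_closed X_carrier Y_carrier by (simp_all add: smult_r_null)

lemma scale_mult:
  assumes "r \<in> carrier R" "s \<in> carrier R" "v \<in> carrier M"
  shows "scale (r \<otimes> s) v = scale r (scale s v)"
  using assms scalar_closed by (simp add: ring_hom_mult[OF scalar_hom] Mod.smult_assoc1)

lemma scale_add:
  assumes "r \<in> carrier R" "s \<in> carrier R" "v \<in> carrier M"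
  shows "scale (r \<oplus> s) v = scale r v \<oplus>\<^bsub>M\<^esub> scale s v"
  using assms scalar_closed by (simp add: ring_hom_add[OF scalar_hom] Mod.smult_l_distr)

lemma scale_one: "v \<in> carrier M \<Longrightarrow> scale \<one> v = v"
  by (simp add: ring_hom_one[OF scalar_hom])

lemma act_relations:
  assumes "v \<in> carrier M"
  shows "Y_act (X_act v) = scale t v" "X_act (Y_act v) = scale (\<sigma> t) v"
    and "r \<in> carrier R \<Longrightarrow> X_act (scale r v) = scale (\<sigma> r) (X_act v)"
    and "r \<in> carrier R \<Longrightarrow> scale r (Y_act v) = Y_act (scale (\<sigma> r) v)"
  using assms scalar_closed X_carrier Y_carrier sigma_closed
  by (simp_all add: wgwa_relations flip: Mod.smult_assoc1)

text \<open>Every element of \<open>A\<close> is the class of a term, so induction on terms reduces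
  closure to the generators. Negatives come from the scalar \<open>\<ominus> \<one>\<close>.\<close>

lemma submodule_from_generators:
  assumes sub: "N \<subseteq> carrier M" and zero: "\<zero>\<^bsub>M\<^esub> \<in> N"
    and add: "\<And>v w. \<lbrakk>v \<in> N; w \<in> N\<rbrakk> \<Longrightarrow> v \<oplus>\<^bsub>M\<^esub> w \<in> N"
    and scale: "\<And>r v. \<lbrakk>r \<in> carrier R; v \<in> N\<rbrakk> \<Longrightarrow> scale r v \<in> N"
    and X: "\<And>v. v \<in> N \<Longrightarrow> X_act v \<in> N"
    and Y: "\<And>v. v \<in> N \<Longrightarrow> Y_act v \<in> N"
  shows "submodule N A M"
proof -
  have neg: "\<ominus>\<^bsub>M\<^esub> v \<in> N" if v: "v \<in> N" for v
  proof -
    have vc: "v \<in> carrier M" using v sub by blast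
    have "scale (\<ominus> \<one>) v \<oplus>\<^bsub>M\<^esub> v = scale (\<ominus> \<one> \<oplus> \<one>) v"
      using vc by (simp add: scale_add scale_one)
    also have "\<dots> = \<zero>\<^bsub>M\<^esub>"
      using vc by (simp add: l_neg wgwa_scalar_def smult_l_null flip: zero_wgwa)
    finally have "scale (\<ominus> \<one>) v = \<ominus>\<^bsub>M\<^esub> v"
      using vc act_closed by (intro Mod.M.minus_equality[symmetric]) auto
    then show ?thesis using scale[OF _ v, of "\<ominus> \<one>"] by simp
  qed
  have cl: "cl p \<odot>\<^bsub>M\<^esub> v \<in> N" if "p \<in> wterms R" "v \<in> N" for p v
    using that
  proof (induction p arbitrary: v)
    case (Scalar r)
    then show ?case using scale by (simp add: wgwa_scalar_def)
  next
    case GenX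
    then show ?case using X by (simp add: wgwa_X_def)
  next
    case GenY
    then show ?case using Y by (simp add: wgwa_Y_def)
  next
    case (Plus p q)
    then have "cl p \<in> carrier A" "cl q \<in> carrier A" by (auto simp: carrier_wgwa)
    then have "cl (Plus p q) \<odot>\<^bsub>M\<^esub> v = cl p \<odot>\<^bsub>M\<^esub> v \<oplus>\<^bsub>M\<^esub> cl q \<odot>\<^bsub>M\<^esub> v"
      using Plus.prems sub Mod.smult_l_distr by (auto simp flip: add_wgwa)
    then show ?case using Plus add by simp
  next
    case (Times p q)
    then have "cl p \<in> carrier A" "cl q \<in> carrier A" by (auto simp: carrier_wgwa)
    then have "cl (Times p q) \<odot>\<^bsub>M\<^esub> v = cl p \<odot>\<^bsub>M\<^esub> (cl q \<odot>\<^bsub>M\<^esub> v)"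
      using Times.prems sub Mod.smult_assoc1 by (auto simp flip: mult_wgwa)
    then show ?case using Times by simp
  next
    case (Neg p)
    then have p: "p \<in> wterms R" "cl p \<in> carrier A" "cl (Neg p) \<in> carrier A"
      by (auto simp: carrier_wgwa)
    have "cl (Neg p) \<oplus>\<^bsub>A\<^esub> cl p = \<zero>\<^bsub>A\<^esub>"
      using p by (auto simp: wgwa_ops class_eq_iff intro: wgwa_rel.plus_neg del: equalityI)
    then have "cl (Neg p) = \<ominus>\<^bsub>A\<^esub> cl p"
      using p by (intro Mod.A.minus_equality[symmetric])
    then have "cl (Neg p) \<odot>\<^bsub>M\<^esub> v = \<ominus>\<^bsub>M\<^esub> (cl p \<odot>\<^bsub>M\<^esub> v)"
      using p Neg.prems sub smult_l_minus by auto
    then show ?case using Neg neg by simp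
  qed
  show ?thesis
  proof (intro submodule.intro)
    show "subgroup N (add_monoid M)"
      using sub zero add neg by (intro Mod.M.add.subgroupI) (auto simp: a_inv_def)
    show "submodule_axioms N A M"
      by unfold_locales (use cl in \<open>auto simp: carrier_wgwa\<close>)
  qed
qed

section \<open>Weight spaces and their sums\<close>

lemma weight_carrier: "v \<in> weight \<mm> \<Longrightarrow> v \<in> carrier M"
  by (simp add: weight_space_def)

lemma weight_zero: "\<mm> \<subseteq> carrier R \<Longrightarrow> \<zero>\<^bsub>M\<^esub> \<in> weight \<mm>"
  by (auto simp: weight_space_def act_zero)

lemma Max_idealsD: "\<mm> \<in> Max_ideals R \<Longrightarrow> \<mm> \<subseteq> carrier R"
  unfolding Max_ideals_def
  by (auto dest!: maximalideal.axioms(1) ideal.axioms(1) additive_subgroup.a_subset)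

lemma weight_scale:
  assumes "\<mm> \<in> Max_ideals R" "r \<in> carrier R" "v \<in> weight \<mm>"
  shows "scale r v \<in> weight \<mm>"
proof -
  have "scale s (scale r v) = \<zero>\<^bsub>M\<^esub>" if s: "s \<in> \<mm>" for s
  proof -
    have sc: "s \<in> carrier R" using s Max_idealsD assms(1) by blast
    have "scale s (scale r v) = scale (s \<otimes> r) v"
      using sc assms(2) weight_carrier[OF assms(3)] by (simp add: scale_mult)
    also have "\<dots> = scale r (scale s v)"
      using sc assms(2) weight_carrier[OF assms(3)] by (simp add: scale_mult m_comm[of s r])
    finally have "scale s (scale r v) = scale r (scale s v)" .
    then show ?thesis using assms s act_zero by (simp add: weight_space_def)
  qed
  moreover have "scale r v \<in> carrier M"
    using assms(2) weight_carrier[OF assms(3)] by (intro act_closed)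
  ultimately show ?thesis by (simp add: weight_space_def)
qed

text \<open>With \<open>b\<close> inverse to \<open>a\<close> modulo \<open>\<mm>\<close>, the
  vector \<open>v\<close> equals \<open>b (a v) + x v\<close> for some \<open>x\<close> in
  \<open>\<mm>\<close>, and both terms vanish.\<close>

lemma weight_annihilator:
  assumes "\<mm> \<in> Max_ideals R" "a \<in> carrier R" "a \<notin> \<mm>" "v \<in> weight \<mm>" "scale a v = \<zero>\<^bsub>M\<^esub>"
  shows "v = \<zero>\<^bsub>M\<^esub>"
proof -
  obtain b x where bx: "b \<in> carrier R" "x \<in> \<mm>" "b \<otimes> a \<oplus> x = \<one>"
    using maximalideal_unit_modulo[of \<mm> a] assms by (auto simp: Max_ideals_def)
  have xc: "x \<in> carrier R" using bx assms(1) Max_idealsD by blast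
  have vc: "v \<in> carrier M" using assms(4) by (rule weight_carrier)
  have "v = scale (b \<otimes> a \<oplus> x) v" using bx vc by (simp add: scale_one)
  also have "\<dots> = scale b (scale a v) \<oplus>\<^bsub>M\<^esub> scale x v"
    using bx(1) xc vc assms(2) by (simp add: scale_add scale_mult)
  also have "\<dots> = \<zero>\<^bsub>M\<^esub>"
    using bx(1,2) assms(4,5) by (simp add: act_zero weight_space_def)
  finally show ?thesis .
qed

text \<open>The internal sum of the weight spaces over \<open>W\<close>, generated one weight vector
  at a time so that rule induction replaces reasoning with \<open>finsum\<close>.\<close>

inductive_set weight_span :: "'a set set \<Rightarrow> 'c set" for W where
  zero: "\<zero>\<^bsub>M\<^esub> \<in> weight_span W"
| add: "\<lbrakk>\<nn> \<in> W; v \<in> weight \<nn>; u \<in> weight_span W\<rbrakk> \<Longrightarrow> v \<oplus>\<^bsub>M\<^esub> u \<in> weight_span W"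

lemma weight_span_carrier: "u \<in> weight_span W \<Longrightarrow> u \<in> carrier M"
  by (induction rule: weight_span.induct) (auto intro: weight_carrier)

lemma weight_span_weight: "\<lbrakk>\<nn> \<in> W; v \<in> weight \<nn>\<rbrakk> \<Longrightarrow> v \<in> weight_span W"
  using weight_span.add[OF _ _ weight_span.zero, of \<nn> W v] weight_carrier[of v \<nn>] by simp

lemma weight_span_add:
  "\<lbrakk>u \<in> weight_span W; u' \<in> weight_span W\<rbrakk> \<Longrightarrow> u \<oplus>\<^bsub>M\<^esub> u' \<in> weight_span W"
proof (induction rule: weight_span.induct)
  case zero
  then show ?case using weight_span_carrier by simp
next
  case (add \<nn> v u)
  then have "v \<oplus>\<^bsub>M\<^esub> u \<oplus>\<^bsub>M\<^esub> u' = v \<oplus>\<^bsub>M\<^esub> (u \<oplus>\<^bsub>M\<^esub> u')"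
    using weight_span_carrier weight_carrier by (simp add: Mod.M.a_assoc)
  then show ?case using add weight_span.add by simp
qed

lemma weight_span_mono: "\<lbrakk>u \<in> weight_span W; W \<subseteq> W'\<rbrakk> \<Longrightarrow> u \<in> weight_span W'"
  by (induction rule: weight_span.induct) (auto intro: weight_span.intros)

text \<open>Meant for scalars, \<open>X_act\<close> and \<open>Y_act\<close>: additivity leaves only
  single weight vectors to check.\<close>

lemma weight_span_image:
  assumes "u \<in> weight_span W"
    and "f \<zero>\<^bsub>M\<^esub> = \<zero>\<^bsub>M\<^esub>"
    and "\<And>v w. \<lbrakk>v \<in> carrier M; w \<in> carrier M\<rbrakk> \<Longrightarrow> f (v \<oplus>\<^bsub>M\<^esub> w) = f v \<oplus>\<^bsub>M\<^esub> f w"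
    and "\<And>\<nn> v. \<lbrakk>\<nn> \<in> W; v \<in> weight \<nn>\<rbrakk> \<Longrightarrow> f v \<in> weight_span W'"
  shows "f u \<in> weight_span W'"
  using assms(1)
proof (induction rule: weight_span.induct)
  case zero
  then show ?case using assms(2) weight_span.zero by simp
next
  case (add \<nn> v u)
  then show ?case
    using assms(3)[OF weight_carrier weight_span_carrier] assms(4) weight_span_add by simp
qed

lemma weight_span_scale:
  assumes "W \<subseteq> Max_ideals R" "r \<in> carrier R" "u \<in> weight_span W"
  shows "scale r u \<in> weight_span W"
  by (rule weight_span_image[OF assms(3)])
    (use assms(1,2) in \<open>auto simp: act_zero act_add intro!: weight_span_weight weight_scale\<close>)

text \<open>Each summand of \<open>u\<close> has a weight different from \<open>\<mm>\<close>, so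
  some scalar outside \<open>\<mm>\<close> kills it. The product of these scalars kills
  \<open>u\<close> and stays outside the prime ideal \<open>\<mm>\<close>.\<close>

lemma weight_span_annihilator:
  assumes "W \<subseteq> Max_ideals R" "\<mm> \<in> Max_ideals R" "\<mm> \<notin> W" "u \<in> weight_span W"
  shows "\<exists>a\<in>carrier R. a \<notin> \<mm> \<and> scale a u = \<zero>\<^bsub>M\<^esub>"
  using assms(4)
proof (induction rule: weight_span.induct)
  case zero
  obtain a where "a \<in> carrier R" "a \<notin> \<mm>"
    using maximalideal_avoidance[of "{}" \<mm>] assms(2) by auto
  then show ?case using act_zero by blast
next
  case (add \<nn> v u)
  then obtain a where a: "a \<in> carrier R" "a \<notin> \<mm>" "scale a u = \<zero>\<^bsub>M\<^esub>" by blast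
  obtain b where b: "b \<in> carrier R" "b \<notin> \<mm>" "b \<in> \<nn>"
    using maximalideal_avoidance[of "{\<nn>}" \<mm>] assms add by auto
  interpret m: primeideal \<mm> R
    using assms(2) maximalideal_prime by (simp add: Max_ideals_def)
  have "a \<otimes> b \<notin> \<mm>" using m.I_prime a b by blast
  moreover have "scale (a \<otimes> b) (v \<oplus>\<^bsub>M\<^esub> u) = \<zero>\<^bsub>M\<^esub>"
  proof -
    have c: "v \<in> carrier M" "u \<in> carrier M"
      using add weight_carrier weight_span_carrier by auto
    have bv: "scale b v = \<zero>\<^bsub>M\<^esub>" using add b by (simp add: weight_space_def)
    have "scale (a \<otimes> b) (v \<oplus>\<^bsub>M\<^esub> u) = scale a (scale b v) \<oplus>\<^bsub>M\<^esub> scale (b \<otimes> a) u"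
      using a b c by (simp add: act_add scale_mult m_comm[of b a])
    also have "\<dots> = \<zero>\<^bsub>M\<^esub>"
      using a b c bv by (simp add: scale_mult act_zero)
    finally show ?thesis .
  qed
  ultimately show ?case using a b by blast
qed

text \<open>Independence of the weight spaces: the scalar outside \<open>\<mm>\<close> that kills
  the sum acts injectively on \<open>weight \<mm>\<close>.\<close>

lemma weight_inter_weight_span:
  assumes "W \<subseteq> Max_ideals R" "\<mm> \<in> Max_ideals R" "\<mm> \<notin> W" "v \<in> weight \<mm>" "v \<in> weight_span W"
  shows "v = \<zero>\<^bsub>M\<^esub>"
  using weight_span_annihilator[OF assms(1-3,5)] weight_annihilator[OF assms(2) _ _ assms(4)] by blast

lemma finsum_weight_span:
  assumes "finite F" "F \<subseteq> W" "\<And>\<nn>. \<nn> \<in> F \<Longrightarrow> f \<nn> \<in> weight \<nn>"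
  shows "finsum M f F \<in> weight_span W"
  using assms
proof (induction F rule: finite_induct)
  case empty
  then show ?case by (simp add: weight_span.zero)
next
  case (insert \<nn> F)
  have "f \<in> F \<rightarrow> carrier M" "f \<nn> \<in> carrier M"
    using insert.prems by (auto intro: weight_carrier)
  then have "finsum M f (insert \<nn> F) = f \<nn> \<oplus>\<^bsub>M\<^esub> finsum M f F"
    using insert.hyps by (simp add: Mod.M.finsum_insert)
  moreover have "\<nn> \<in> W" "f \<nn> \<in> weight \<nn>" "finsum M f F \<in> weight_span W"
    using insert by auto
  ultimately show ?case by (simp add: weight_span.add)
qed

text \<open>The annihilator of \<open>v\<close> restricts its weights: once a component is isolated
  by a scalar, an element of \<open>J\<close> outside its weight would kill it. Empty
  \<open>J\<close> just writes \<open>v\<close> as a sum of weight vectors; the image of an ideal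
  under \<open>\<sigma>\<close> serves to locate the weights of \<open>X v\<close>.\<close>

lemma weight_module_span:
  assumes wm: "weight_module R \<sigma> t M" and v: "v \<in> carrier M"
    and J: "J \<subseteq> carrier R" "\<And>r. r \<in> J \<Longrightarrow> scale r v = \<zero>\<^bsub>M\<^esub>"
  shows "v \<in> weight_span {\<nn> \<in> Max_ideals R. J \<subseteq> \<nn>}"
proof -
  obtain f where f: "f \<in> (\<Pi>\<^sub>E \<nn>\<in>Max_ideals R. weight \<nn>)"
    and fin: "finite {\<nn> \<in> Max_ideals R. f \<nn> \<noteq> \<zero>\<^bsub>M\<^esub>}"
    and sum: "v = finsum M f {\<nn> \<in> Max_ideals R. f \<nn> \<noteq> \<zero>\<^bsub>M\<^esub>}"
    using wm v unfolding weight_module_def by blast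
  define F where "F = {\<nn> \<in> Max_ideals R. f \<nn> \<noteq> \<zero>\<^bsub>M\<^esub>}"
  have fw: "f \<nn> \<in> weight \<nn>" if "\<nn> \<in> F" for \<nn>
    using f that by (auto simp: F_def)
  have "J \<subseteq> \<nn>" if n: "\<nn> \<in> F" for \<nn>
  proof
    fix r assume r: "r \<in> J"
    then have rc: "r \<in> carrier R" using J by blast
    show "r \<in> \<nn>"
    proof (rule ccontr)
      assume rn: "r \<notin> \<nn>"
      define u where "u = finsum M f (F - {\<nn>})"
      have nM: "\<nn> \<in> Max_ideals R" and nz: "f \<nn> \<noteq> \<zero>\<^bsub>M\<^esub>" using n by (auto simp: F_def)
      have u: "u \<in> weight_span (F - {\<nn>})"
        unfolding u_def using fin fw by (intro finsum_weight_span) (auto simp: F_def)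
      have uc: "u \<in> carrier M" using u by (rule weight_span_carrier)
      have fc: "f \<nn> \<in> carrier M" using fw[OF n] by (rule weight_carrier)
      have "finsum M f (insert \<nn> (F - {\<nn>})) = f \<nn> \<oplus>\<^bsub>M\<^esub> u"
        unfolding u_def using fin fc fw[THEN weight_carrier]
        by (intro Mod.M.finsum_insert) (auto simp: F_def)
      then have vu: "v = f \<nn> \<oplus>\<^bsub>M\<^esub> u"
        using n sum unfolding F_def[symmetric] by (simp add: insert_absorb)
      \<comment> \<open>\<open>a\<close> removes all components but \<open>f \<nn>\<close> and acts
        injectively on \<open>weight \<nn>\<close>.\<close>
      obtain a where a: "a \<in> carrier R" "a \<notin> \<nn>" "scale a u = \<zero>\<^bsub>M\<^esub>"
        using weight_span_annihilator[OF _ nM _ u] by (auto simp: F_def)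
      have "scale a v = scale a (f \<nn>)"
        unfolding vu using a fc uc act_closed by (simp add: act_add)
      then have "scale r (scale a (f \<nn>)) = scale (r \<otimes> a) v"
        using rc a v by (simp add: scale_mult)
      also have "\<dots> = scale a (scale r v)"
        using rc a v by (simp add: scale_mult m_comm[of r a])
      also have "\<dots> = \<zero>\<^bsub>M\<^esub>" using J(2)[OF r] a act_zero by simp
      finally have "scale a (f \<nn>) = \<zero>\<^bsub>M\<^esub>"
        using weight_annihilator[OF nM rc rn weight_scale[OF nM a(1) fw[OF n]]] by blast
      then show False using weight_annihilator[OF nM a(1,2) fw[OF n]] nz by blast
    qed
  qed
  then have "finsum M f F \<in> weight_span {\<nn> \<in> Max_ideals R. J \<subseteq> \<nn>}"
    using fin fw by (intro finsum_weight_span) (auto simp: F_def)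
  then show ?thesis using sum by (simp add: F_def)
qed

lemma weight_span_supp:
  assumes "u \<in> weight_span W" "W \<subseteq> Max_ideals R"
  shows "u \<in> weight_span (W \<inter> weight_supp R \<sigma> t M)"
  using assms
proof (induction rule: weight_span.induct)
  case zero
  show ?case by (rule weight_span.zero)
next
  case (add \<nn> v u)
  show ?case
  proof (cases "v = \<zero>\<^bsub>M\<^esub>")
    case True
    then show ?thesis using add weight_span_carrier by simp
  next
    case False
    then have "\<nn> \<in> weight_supp R \<sigma> t M" using add by (auto simp: weight_supp_def)
    then show ?thesis using add by (auto intro: weight_span.add)
  qed
qed

lemma weight_span_empty: "u \<in> weight_span {} \<Longrightarrow> u = \<zero>\<^bsub>M\<^esub>"
  by (induction rule: weight_span.induct) auto

lemma weight_supp_nonzero: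
  assumes "\<mm> \<in> weight_supp R \<sigma> t M"
  obtains v where "v \<in> weight \<mm>" "v \<noteq> \<zero>\<^bsub>M\<^esub>"
  using assms weight_zero[of \<mm>] Max_idealsD by (auto simp: weight_supp_def)

section \<open>How \<open>X\<close> and \<open>Y\<close> move weights\<close>

lemma weight_Y:
  assumes "v \<in> weight \<nn>"
  shows "Y_act v \<in> weight (pullback R \<sigma> \<nn>)"
  using assms act_closed
  by (auto simp: weight_space_def pullback_def act_relations act_zero)

text \<open>By \<open>X r = \<sigma>(r) X\<close>, the set \<open>\<sigma>(\<nn>)\<close> kills
  \<open>X v\<close>, so each weight \<open>\<kk>\<close> that occurs has \<open>\<nn>\<close>
  inside its pullback. That pullback is maximal by essentiality, and the two coincide.\<close>

lemma weight_X:
  assumes ess: "essential_endo R \<sigma>" and wm: "weight_module R \<sigma> t M"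
    and n: "\<nn> \<in> Max_ideals R" and v: "v \<in> weight \<nn>"
  shows "X_act v \<in> weight_span {\<kk> \<in> Max_ideals R. pullback R \<sigma> \<kk> = \<nn>}"
proof -
  have vc: "v \<in> carrier M" using v by (rule weight_carrier)
  have nR: "\<nn> \<subseteq> carrier R" using n by (rule Max_idealsD)
  have "X_act v \<in> weight_span {\<kk> \<in> Max_ideals R. \<sigma> ` \<nn> \<subseteq> \<kk>}"
  proof (rule weight_module_span[OF wm])
    fix s assume "s \<in> \<sigma> ` \<nn>"
    then obtain r where r: "r \<in> \<nn>" "s = \<sigma> r" by blast
    then have "scale s (X_act v) = X_act (scale r v)"
      using act_relations(3)[OF vc, of r] nR by auto
    then show "scale s (X_act v) = \<zero>\<^bsub>M\<^esub>"
      using r v act_zero by (simp add: weight_space_def)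
  qed (use nR sigma_closed act_closed vc in auto)
  then show ?thesis
  proof (rule weight_span_mono, intro subsetI)
    fix \<kk> assume k: "\<kk> \<in> {\<kk> \<in> Max_ideals R. \<sigma> ` \<nn> \<subseteq> \<kk>}"
    then have "\<nn> \<subseteq> pullback R \<sigma> \<kk>" using nR by (auto simp: pullback_def)
    moreover have "pullback R \<sigma> \<kk> \<in> Max_ideals R"
      using k pullback_Max_ideals[OF ess sigma_hom] by blast
    ultimately show "\<kk> \<in> {\<kk> \<in> Max_ideals R. pullback R \<sigma> \<kk> = \<nn>}"
      using k Max_ideals_eqI[OF n] by blast
  qed
qed

section \<open>Comparability and lifting inside the support of a simple module\<close>

inductive_set Y_closure :: "'c set \<Rightarrow> 'c set" for K where
  base: "u \<in> K \<Longrightarrow> u \<in> Y_closure K"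
| Y: "u \<in> Y_closure K \<Longrightarrow> Y_act u \<in> Y_closure K"
| add: "\<lbrakk>u \<in> Y_closure K; u' \<in> Y_closure K\<rbrakk> \<Longrightarrow> u \<oplus>\<^bsub>M\<^esub> u' \<in> Y_closure K"

lemma Y_closure_carrier: "\<lbrakk>u \<in> Y_closure K; K \<subseteq> carrier M\<rbrakk> \<Longrightarrow> u \<in> carrier M"
  by (induction rule: Y_closure.induct) (auto simp: act_closed)

text \<open>Since \<open>XY = \<sigma>(t)\<close>, an \<open>X\<close> applied after a \<open>Y\<close> cancels, so closing under \<open>Y\<close> suffices.\<close>

lemma submodule_Y_closure:
  assumes K: "K \<subseteq> carrier M" "\<zero>\<^bsub>M\<^esub> \<in> K"
    and scale: "\<And>r v. \<lbrakk>r \<in> carrier R; v \<in> K\<rbrakk> \<Longrightarrow> scale r v \<in> K"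
    and X: "\<And>v. v \<in> K \<Longrightarrow> X_act v \<in> K"
  shows "submodule (Y_closure K) A M"
proof -
  \<comment> \<open>Scalars pass through \<open>Y\<close> by \<open>r Y = Y \<sigma>(r)\<close>
    until \<open>K\<close> absorbs them. The same fact later absorbs the scalar
    \<open>\<sigma>(t)\<close> left over from \<open>XY\<close>.\<close>
  have scaleY: "scale r u \<in> Y_closure K" if "u \<in> Y_closure K" "r \<in> carrier R" for r u
    using that
  proof (induction arbitrary: r rule: Y_closure.induct)
    case (base u)
    then show ?case using scale Y_closure.base by blast
  next
    case (Y u)
    then show ?case
      using act_relations(4)[OF Y_closure_carrier[OF Y.hyps K(1)]] sigma_closed Y_closure.Y by simp
  next
    case (add u u')
    then show ?case
      using Y_closure_carrier[OF _ K(1)] act_add(1)[of u u' r] Y_closure.add by simp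
  qed
  have XY: "X_act u \<in> Y_closure K" if "u \<in> Y_closure K" for u
    using that
  proof (induction rule: Y_closure.induct)
    case (base u)
    then show ?case using X Y_closure.base by blast
  next
    case (Y u)
    then show ?case
      using act_relations(2)[OF Y_closure_carrier[OF Y.hyps K(1)]] sigma_closed t_carrier scaleY
      by simp
  next
    case (add u u')
    then show ?case
      using Y_closure_carrier[OF _ K(1)] act_add(2)[of u u'] Y_closure.add by simp
  qed
  show ?thesis
    using Y_closure_carrier[OF _ K(1)] K(2) scaleY XY
    by (intro submodule_from_generators) (auto intro: Y_closure.intros)
qed

lemma weight_supp_comparable:
  assumes ess: "essential_endo R \<sigma>" and wm: "weight_module R \<sigma> t M"
    and simple: "simple_left_module A M"
    and m: "\<mm> \<in> weight_supp R \<sigma> t M" and n: "\<nn> \<in> weight_supp R \<sigma> t M"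
  shows "\<exists>k. (pullback R \<sigma> ^^ k) \<mm> = \<nn> \<or> (pullback R \<sigma> ^^ k) \<nn> = \<mm>"
proof -
  let ?\<tau> = "pullback R \<sigma>"
  \<comment> \<open>Two sets are needed because \<open>Y\<close> may lead out of \<open>L\<close>.
    Lifts stay in \<open>L\<close>, so \<open>X\<close> preserves its span; \<open>C\<close>, the
    ideals comparable with \<open>\<mm>\<close>, is closed under \<open>?\<tau>\<close>, so repeated
    \<open>Y\<close> leads from the span of \<open>L\<close> only into that of
    \<open>C\<close>.\<close>
  define L where "L = {\<kk> \<in> Max_ideals R. \<exists>k. (?\<tau> ^^ k) \<kk> = \<mm>}"
  define C where "C = L \<union> {\<kk> \<in> Max_ideals R. \<exists>k. (?\<tau> ^^ k) \<mm> = \<kk>}"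
  have mM: "\<mm> \<in> Max_ideals R" and nM: "\<nn> \<in> Max_ideals R"
    using m n by (auto simp: weight_supp_def)
  have LM: "L \<subseteq> Max_ideals R" and CM: "C \<subseteq> Max_ideals R"
    by (auto simp: L_def C_def)
  have mL: "\<mm> \<in> L" using mM by (auto simp: L_def intro: exI[of _ 0])
  have L_up: "\<kk> \<in> L" if "\<kk> \<in> Max_ideals R" "?\<tau> \<kk> \<in> L" for \<kk>
  proof -
    obtain k where "(?\<tau> ^^ k) (?\<tau> \<kk>) = \<mm>" using \<open>?\<tau> \<kk> \<in> L\<close> by (auto simp: L_def)
    then have "(?\<tau> ^^ Suc k) \<kk> = \<mm>" by (simp add: funpow_swap1)
    then show ?thesis unfolding L_def using that(1) by blast
  qed
  have C_down: "?\<tau> \<kk> \<in> C" if k: "\<kk> \<in> C" for \<kk>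
  proof -
    have tM: "?\<tau> \<kk> \<in> Max_ideals R"
      using k CM pullback_Max_ideals[OF ess sigma_hom] by blast
    consider j where "(?\<tau> ^^ j) \<kk> = \<mm>" | j where "(?\<tau> ^^ j) \<mm> = \<kk>"
      using k unfolding C_def L_def by blast
    then show ?thesis
    proof cases
      case (1 j)
      show ?thesis
      proof (cases j)
        \<comment> \<open>Here \<open>\<kk>\<close> is \<open>\<mm>\<close> itself, so one more step
          enters the second half of \<open>C\<close>.\<close>
        case 0
        then have "(?\<tau> ^^ 1) \<mm> = ?\<tau> \<kk>" using 1 by simp
        then show ?thesis unfolding C_def using tM by blast
      next
        case (Suc i)
        then have "(?\<tau> ^^ i) (?\<tau> \<kk>) = \<mm>" using 1 by (simp add: funpow_swap1)
        then show ?thesis unfolding C_def L_def using tM by blast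
      qed
    next
      case (2 j)
      then have "(?\<tau> ^^ Suc j) \<mm> = ?\<tau> \<kk>" by simp
      then show ?thesis unfolding C_def using tM by blast
    qed
  qed
  let ?N = "Y_closure (weight_span L)"
  have "submodule ?N A M"
  proof (rule submodule_Y_closure)
    fix v assume v: "v \<in> weight_span L"
    show "X_act v \<in> weight_span L"
    proof (rule weight_span_image[OF v])
      fix \<kk> v assume k: "\<kk> \<in> L" "v \<in> weight \<kk>"
      then have "X_act v \<in> weight_span {\<kk>' \<in> Max_ideals R. ?\<tau> \<kk>' = \<kk>}"
        using weight_X[OF ess wm] LM by blast
      then show "X_act v \<in> weight_span L"
        by (rule weight_span_mono) (use k L_up in auto)
    qed (auto simp: act_zero act_add)
  qed (auto simp: weight_span.zero intro: weight_span_carrier weight_span_scale[OF LM])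
  moreover obtain w where w: "w \<in> weight \<mm>" "w \<noteq> \<zero>\<^bsub>M\<^esub>" using m by (rule weight_supp_nonzero)
  then have "w \<in> ?N" using weight_span_weight[OF mL] Y_closure.base by blast
  ultimately have N: "?N = carrier M" using simple w(2) unfolding simple_left_module_def by blast
  have NC: "u \<in> weight_span C" if "u \<in> ?N" for u
    using that
  proof (induction rule: Y_closure.induct)
    case (base u)
    then show ?case by (rule weight_span_mono) (simp add: C_def)
  next
    case (Y u)
    show ?case
    proof (rule weight_span_image[OF Y.IH])
      fix \<kk> v assume "\<kk> \<in> C" "v \<in> weight \<kk>"
      then show "Y_act v \<in> weight_span C"
        by (intro weight_span_weight[OF C_down weight_Y])
    qed (auto simp: act_zero act_add)
  next
    case (add u u')
    then show ?case using weight_span_add by blast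
  qed
  obtain v where v: "v \<in> weight \<nn>" "v \<noteq> \<zero>\<^bsub>M\<^esub>" using n by (rule weight_supp_nonzero)
  then have "v \<in> weight_span C" using NC N weight_carrier by blast
  then have "\<nn> \<in> C" using weight_inter_weight_span[OF CM nM _ v(1)] v(2) by blast
  then show ?thesis unfolding C_def L_def by blast
qed

text \<open>Supplies the lifting hypothesis of \<open>comparable_orbit_cover\<close>, with
  \<open>t \<in> \<mm>\<close> as the predicate \<open>T\<close>. Without a lift in the support,
  \<open>X v\<close> vanishes and so does \<open>t v = Y X v\<close>, whereas \<open>t\<close>
  outside \<open>\<mm>\<close> acts injectively on \<open>weight \<mm>\<close>.\<close>

lemma weight_supp_preimage:
  assumes ess: "essential_endo R \<sigma>" and wm: "weight_module R \<sigma> t M"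
    and m: "\<mm> \<in> weight_supp R \<sigma> t M" and tm: "t \<notin> \<mm>"
  shows "\<exists>\<nn>\<in>weight_supp R \<sigma> t M. pullback R \<sigma> \<nn> = \<mm>"
proof (rule ccontr)
  assume none: "\<not> ?thesis"
  have mM: "\<mm> \<in> Max_ideals R" using m by (simp add: weight_supp_def)
  obtain v where v: "v \<in> weight \<mm>" "v \<noteq> \<zero>\<^bsub>M\<^esub>" using m by (rule weight_supp_nonzero)
  let ?W = "{\<kk> \<in> Max_ideals R. pullback R \<sigma> \<kk> = \<mm>}"
  have "X_act v \<in> weight_span (?W \<inter> weight_supp R \<sigma> t M)"
    by (rule weight_span_supp[OF weight_X[OF ess wm mM v(1)]]) blast
  moreover have "?W \<inter> weight_supp R \<sigma> t M = {}" using none by blast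
  ultimately have "X_act v = \<zero>\<^bsub>M\<^esub>" using weight_span_empty by simp
  then have "scale t v = \<zero>\<^bsub>M\<^esub>"
    using act_relations(1)[OF weight_carrier[OF v(1)]] act_zero by simp
  then show False using weight_annihilator[OF mM t_carrier tm v(1)] v(2) by blast
qed

lemma weight_supp_nonempty:
  assumes wm: "weight_module R \<sigma> t M" and simple: "simple_left_module A M"
  shows "weight_supp R \<sigma> t M \<noteq> {}"
proof
  assume empty: "weight_supp R \<sigma> t M = {}"
  have "v = \<zero>\<^bsub>M\<^esub>" if "v \<in> carrier M" for v
  proof -
    \<comment> \<open>The empty \<open>J\<close> imposes no condition on \<open>v\<close>.\<close>
    have "v \<in> weight_span {\<nn> \<in> Max_ideals R. {} \<subseteq> \<nn>}"
      by (rule weight_module_span[OF wm that]) auto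
    then have "v \<in> weight_span ({\<nn> \<in> Max_ideals R. {} \<subseteq> \<nn>} \<inter> weight_supp R \<sigma> t M)"
      by (rule weight_span_supp) blast
    then show ?thesis using weight_span_empty empty by simp
  qed
  then show False using simple Mod.M.zero_closed unfolding simple_left_module_def by blast
qed

end

section \<open>From the covering chain to an indexed family of maximal ideals\<close>

theorem proposition22:
  fixes R :: "('r, 's) ring_scheme"
    and \<sigma> :: "'r \<Rightarrow> 'r"
    and t :: 'r
    and M :: "('r wterm set, 'm, 'u) module_scheme"
  assumes "cring R"
    and "\<sigma> \<in> ring_hom R R"
    and "essential_endo R \<sigma>"
    and "t \<in> carrier R"
    and "simple_left_module (wgwa R \<sigma> t) M"
    and "weight_module R \<sigma> t M"
  shows "\<exists>(I, m) \<in> Q_biinf R \<sigma> \<union> Q_right R \<sigma> t \<union> Q_left R \<sigma> t \<union> (\<Union>n. Q_fin R \<sigma> t n).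
    weight_supp R \<sigma> t M \<subseteq> m ` I"
proof -
  have "left_module (wgwa R \<sigma> t) M" using assms(5) by (simp add: simple_left_module_def)
  then interpret wgwa_module R \<sigma> t M
    using assms by (intro wgwa_module.intro wgwa_data.intro wgwa_data_axioms.intro)
  let ?\<tau> = "pullback R \<sigma>" and ?S = "weight_supp R \<sigma> t M"
  have SM: "?S \<subseteq> Max_ideals R" by (auto simp: weight_supp_def)
  have orbit: "(?\<tau> ^^ k) \<mm> \<in> Max_ideals R" if "\<mm> \<in> Max_ideals R" for k \<mm>
    using that by (induction k) (simp_all add: pullback_Max_ideals[OF assms(3,2)])
  \<comment> \<open>This turns \<open>?\<tau> (c (i + 1)) = c i\<close> into the inclusion that
    defines a chain of ideals.\<close>
  have image: "\<sigma> ` ?\<tau> \<mm> \<subseteq> \<mm>" for \<mm> by (auto simp: pullback_def)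
  have "(\<exists>s\<in>?S. t \<in> s \<and> ?S \<subseteq> (\<lambda>k. (?\<tau> ^^ k) s) ` UNIV) \<or>
    (\<exists>c::int \<Rightarrow> 'r set. (\<forall>i. ?\<tau> (c (i + 1)) = c i) \<and> ?S \<subseteq> range c \<and>
      range c \<subseteq> {(?\<tau> ^^ k) s |k s. s \<in> ?S})"
    by (rule comparable_orbit_cover[OF weight_supp_nonempty[OF assms(6,5)]
          weight_supp_comparable[OF assms(3,6,5)] weight_supp_preimage[OF assms(3,6)]])
  then consider s where "s \<in> ?S" "t \<in> s" "?S \<subseteq> (\<lambda>k. (?\<tau> ^^ k) s) ` UNIV"
    | c :: "int \<Rightarrow> 'r set" where "\<forall>i. ?\<tau> (c (i + 1)) = c i" "?S \<subseteq> range c"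
      "range c \<subseteq> {(?\<tau> ^^ k) s |k s. s \<in> ?S}"
    by (elim disjE bexE exE conjE)
  then show ?thesis
  proof cases
    case (1 s)
    \<comment> \<open>The orbit of \<open>s\<close> runs leftwards from index 0, where
      \<open>t \<in> s\<close> is the required end condition. \<open>restrict\<close> makes
      \<open>m\<close> undefined off the index set, as the extensional function space in
      \<open>max_chains\<close> demands.\<close>
    define m where "m = restrict (\<lambda>i::int. (?\<tau> ^^ nat (- i)) s) {..0}"
    have m_eq: "m (- int k) = (?\<tau> ^^ k) s" for k by (simp add: m_def)
    have "m \<in> max_chains R \<sigma> {..0}"
      unfolding max_chains_def
    proof (intro CollectI conjI allI impI)
      show "m \<in> {..0} \<rightarrow>\<^sub>E Max_ideals R"
        using orbit[OF subsetD[OF SM 1(1)]] by (simp add: m_def)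
      fix i :: int assume i: "i \<in> {..0} \<and> i + 1 \<in> {..0}"
      then have "i + 1 \<le> 0" by simp
      then obtain k where k: "i + 1 = - int k" by (rule nonpos_int_cases)
      then have "i = - int (Suc k)" by simp
      then have "m i = ?\<tau> (m (i + 1))" unfolding k by (simp only: m_eq funpow.simps comp_apply)
      then show "\<sigma> ` m i \<subseteq> m (i + 1)" using image by simp
    qed
    moreover have "t \<in> m 0" using 1(2) by (simp add: m_def)
    ultimately have "({..0}, m) \<in> Q_left R \<sigma> t" by (simp add: Q_left_def)
    moreover have "?S \<subseteq> m ` {..0}"
    proof
      fix d assume "d \<in> ?S"
      then obtain k where "d = (?\<tau> ^^ k) s" using 1(3) by blast
      then have "d = m (- int k)" by (simp only: m_eq)
      then show "d \<in> m ` {..0}" by (rule image_eqI) simp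
    qed
    ultimately show ?thesis by blast
  next
    case (2 c)
    have "c \<in> max_chains R \<sigma> UNIV"
      unfolding max_chains_def
    proof (intro CollectI conjI allI impI)
      have "c i \<in> Max_ideals R" for i
      proof -
        have "c i \<in> {(?\<tau> ^^ k) s |k s. s \<in> ?S}" using 2(3) by (rule subsetD) simp
        then show ?thesis using SM orbit by auto
      qed
      then show "c \<in> UNIV \<rightarrow>\<^sub>E Max_ideals R" by (simp add: PiE_iff)
      fix i :: int
      show "\<sigma> ` c i \<subseteq> c (i + 1)" using image[of "c (i + 1)"] unfolding spec[OF 2(1)] .
    qed
    then have "(UNIV, c) \<in> Q_biinf R \<sigma>" by (simp add: Q_biinf_def)
    then show ?thesis using 2(2) by blast
  qed
qed

end
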